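(* Let $n \in \mathbb N$, let $d \in \mathbb N$ be odd, and let $p \in {\rm Pol}(M_n(\mathbb C))$ be a self-adjoint matrix polynomial of degree $d$. Assume that its leading form $p^{(d)}$ is non-degenerate. Then there exists a self-adjoint matrix $X \in M_n(\mathbb C)_h$ such that $p(X)=0$.
   Context: Fix $n \in \mathbb N$. $M_n(\mathbb C)$ is the algebra of complex $(n\times n)$-matrices and $M_n(\mathbb C)_h$ is the real vector space of self-adjoint (Hermitian) matrices. The polynomial algebra is the graded unital ring ${\rm Pol}(M_n(\mathbb C)) = \bigoplus_{d=0}^{\infty} M_n(\mathbb C)^{\otimes (d+1)}$ (tensor products over $\mathbb C$; the summand $M_n(\mathbb C)^{\otimes(d+1)}$ is the part of degree $d$), with multiplication $(A_0 \otimes \cdots \otimes A_d)\cdot (B_0 \otimes \cdots \otimes B_{d'})= A_0 \otimes \cdots \otimes A_{d-1} \otimes A_dB_0 \otimes B_1 \otimes \cdots \otimes B_{d'}$. An element is evaluated at $X \in M_n(\mathbb C)$ by linear extension of $(A_0 \otimes \cdots \otimes A_d)(X) = A_0XA_1X \cdots A_{d-1}XA_d$. The degree of a non-zero $p$ is the largest $d$ for which its component in degree $d$ is non-zero (the zero polynomial has degree $-\infty$); this degree is that of the element of ${\rm Pol}(M_n(\mathbb C))$. The leading form $p^{(d)}$ of $p$ of degree $d$ is its component in degree $d$. The involution on ${\rm Pol}(M_n(\mathbb C))$ is the conjugate-linear map with $(A_0 \otimes \cdots \otimes A_d)^* = A_d^* \otimes \cdots \otimes A_0^*$; $p$ is self-adjoint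 if $p^*=p$. Then $p(X)^*=p^*(X^* )$, so a self-adjoint $p$ maps $M_n(\mathbb C)_h$ to itself. A self-adjoint homogeneous $q \in {\rm Pol}(M_n(\mathbb C))$ is non-degenerate if, for $X \in M_n(\mathbb C)_h$, $q(X)=0$ implies $X=0$. *)

theory Defs
  imports "HOL-Analysis.Analysis" "HOL-Library.Poly_Mapping"
begin

abbreviation (input) "lookup \<equiv> Poly_Mapping.lookup"
abbreviation (input) "keys \<equiv> Poly_Mapping.keys"

section \<open>Complex matrices\<close>

type_synonym 'n cmat = "complex ^ 'n ^ 'n"

definition mscale :: "complex \<Rightarrow> 'n::finite cmat \<Rightarrow> 'n cmat" where
  "mscale c A = map_matrix ((*) c) A"

definition adj :: "'n::finite cmat \<Rightarrow> 'n cmat" where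
  "adj A = map_matrix cnj (transpose A)"

definition hermitian :: "'n::finite cmat \<Rightarrow> bool" where
  "hermitian A \<longleftrightarrow> adj A = A"

lemma mscale_nth [simp]: "mscale c A $ i $ j = c * A $ i $ j"
  by (simp add: mscale_def)

lemma adj_nth [simp]: "adj A $ i $ j = cnj (A $ j $ i)"
  by (simp add: adj_def transpose_def)

lemma adj_add: "adj (A + B) = adj A + adj B"
  by (simp add: vec_eq_iff)

lemma adj_mscale: "adj (mscale c A) = mscale (cnj c) (adj A)"
  by (simp add: vec_eq_iff)

lemma adj_adj [simp]: "adj (adj A) = A"
  by (simp add: vec_eq_iff)

lemma adj_mult: "adj (A ** B) = adj B ** adj A"
  by (simp add: vec_eq_iff matrix_matrix_mult_def mult.commute)

section \<open>The direct sum of the tensor powers of the matrix algebra\<close>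

text \<open>
  A finitely supported function on nonempty lists is a formal complex linear combination of words
  \<open>[A\<^sub>0, \<dots>, A\<^sub>d]\<close>, one word for each generator of each tensor power of
  order \<open>d + 1\<close>. The following is the linear span of the multilinearity relations. They
  relate words of the same length only, so dividing by it gives the direct sum over \<open>d\<close> of
  the tensor powers.
\<close>

type_synonym 'n formal = "'n cmat list \<Rightarrow>\<^sub>0 complex"

inductive_set tensor_null :: "'n::finite formal set" where
  zero: "0 \<in> tensor_null"
| add: "p \<in> tensor_null \<Longrightarrow> q \<in> tensor_null \<Longrightarrow> p + q \<in> tensor_null"
| scale: "p \<in> tensor_null \<Longrightarrow> Poly_Mapping.map ((*) c) p \<in> tensor_null"
| additive: "Poly_Mapping.single (us @ (A + B) # vs) 1 - Poly_Mapping.single (us @ A # vs) 1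
      - Poly_Mapping.single (us @ B # vs) 1 \<in> tensor_null"
| homogeneous: "Poly_Mapping.single (us @ mscale c A # vs) 1 - Poly_Mapping.single (us @ A # vs) c
      \<in> tensor_null"

lemma lookup_map_scale: "lookup (Poly_Mapping.map ((*) c) p) w = c * lookup p (w :: 'a)"
  for c :: complex
  by (simp add: Poly_Mapping.map.rep_eq when_def)

lemma map_scale_add:
  "Poly_Mapping.map ((*) c) (p + q) = Poly_Mapping.map ((*) c) p + Poly_Mapping.map ((*) c) q"
  for p q :: "'a \<Rightarrow>\<^sub>0 complex"
  by (rule poly_mapping_eqI) (simp add: lookup_map_scale lookup_add ring_distribs)

lemma map_scale_minus_one: "Poly_Mapping.map ((*) (- 1)) p = - p"
  for p :: "'a \<Rightarrow>\<^sub>0 complex"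
  by (rule poly_mapping_eqI) (simp add: lookup_map_scale)

lemma map_scale_diff:
  "Poly_Mapping.map ((*) c) (p - q) = Poly_Mapping.map ((*) c) p - Poly_Mapping.map ((*) c) q"
  for p q :: "'a \<Rightarrow>\<^sub>0 complex"
  by (rule poly_mapping_eqI) (simp add: lookup_map_scale lookup_minus right_diff_distrib)

lemma map_scale_single:
  "Poly_Mapping.map ((*) c) (Poly_Mapping.single w (a :: complex)) = Poly_Mapping.single w (c * a)"
  by (rule poly_mapping_eqI) (simp add: lookup_map_scale lookup_single when_def)

lemma tensor_null_uminus: "p \<in> tensor_null \<Longrightarrow> - p \<in> tensor_null"
  using tensor_null.scale[of p "- 1"] by (simp add: map_scale_minus_one)

lemma tensor_null_diff: "p \<in> tensor_null \<Longrightarrow> q \<in> tensor_null \<Longrightarrow> p - q \<in> tensor_null"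
  using tensor_null.add[of p "- q"] tensor_null_uminus[of q] by simp

definition tensor_rel :: "'n::finite formal \<Rightarrow> 'n formal \<Rightarrow> bool" where
  "tensor_rel p q \<longleftrightarrow> [] \<notin> keys p \<and> [] \<notin> keys q \<and> p - q \<in> tensor_null"

quotient_type 'n matpoly = "'n::finite formal" / partial: tensor_rel
proof (rule part_equivpI)
  show "\<exists>p. tensor_rel p (p :: 'n formal)"
    by (rule exI[of _ 0]) (simp add: tensor_rel_def tensor_null.zero)
  show "symp (tensor_rel :: 'n formal \<Rightarrow> _)"
  proof (rule sympI)
    fix p q :: "'n formal" assume "tensor_rel p q"
    then show "tensor_rel q p"
      using tensor_null_uminus[of "p - q"] by (simp add: tensor_rel_def)
  qed
  show "transp (tensor_rel :: 'n formal \<Rightarrow> _)"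
  proof (rule transpI)
    fix p q r :: "'n formal" assume "tensor_rel p q" "tensor_rel q r"
    then show "tensor_rel p r"
      using tensor_null.add[of "p - q" "q - r"] by (simp add: tensor_rel_def)
  qed
qed

lemma Nil_not_in_keys: "[] \<notin> keys p \<longleftrightarrow> lookup p [] = 0"
  by (simp add: in_keys_iff)

instantiation matpoly :: (finite) ab_group_add
begin

lift_definition zero_matpoly :: "'a matpoly" is 0
  by (simp add: tensor_rel_def tensor_null.zero)

lift_definition plus_matpoly :: "'a matpoly \<Rightarrow> 'a matpoly \<Rightarrow> 'a matpoly" is "(+)"
  unfolding tensor_rel_def Nil_not_in_keys
  by (auto simp: lookup_add add_diff_add intro: tensor_null.add)

lift_definition uminus_matpoly :: "'a matpoly \<Rightarrow> 'a matpoly" is uminus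
  unfolding tensor_rel_def Nil_not_in_keys
  by (auto dest: tensor_null_uminus)

definition minus_matpoly :: "'a matpoly \<Rightarrow> 'a matpoly \<Rightarrow> 'a matpoly" where
  "minus_matpoly p q = p + - q"

instance
proof
  fix a b c :: "'a matpoly"
  show "a + b + c = a + (b + c)"
    by transfer (simp add: tensor_rel_def Nil_not_in_keys lookup_add tensor_null.zero add.assoc)
  show "a + b = b + a"
    by transfer (simp add: tensor_rel_def Nil_not_in_keys lookup_add tensor_null.zero add.commute)
  show "0 + a = a"
    by transfer (simp add: tensor_rel_def Nil_not_in_keys lookup_add tensor_null.zero)
  show "- a + a = 0"
    by transfer (simp add: tensor_rel_def Nil_not_in_keys lookup_add tensor_null.zero)
  show "a - b = a + - b"
    by (simp add: minus_matpoly_def)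
qed

end

lift_definition pol_scale :: "complex \<Rightarrow> 'n::finite matpoly \<Rightarrow> 'n matpoly"
  is "\<lambda>c. Poly_Mapping.map ((*) c)"
  unfolding tensor_rel_def Nil_not_in_keys
  by (auto simp: lookup_map_scale simp flip: map_scale_diff intro: tensor_null.scale)

lift_definition tensor :: "'n::finite cmat list \<Rightarrow> 'n matpoly"
  is "\<lambda>w. if w = [] then 0 else Poly_Mapping.single w 1"
  by (auto simp: tensor_rel_def tensor_null.zero)

lemma tensor_add: "tensor (us @ (A + B) # vs) = tensor (us @ A # vs) + tensor (us @ B # vs)"
proof transfer
  fix us vs :: "'a cmat list" and A B :: "'a cmat"
  show "tensor_rel (if us @ (A + B) # vs = [] then 0 else Poly_Mapping.single (us @ (A + B) # vs) 1)
      ((if us @ A # vs = [] then 0 else Poly_Mapping.single (us @ A # vs) 1) +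
       (if us @ B # vs = [] then 0 else Poly_Mapping.single (us @ B # vs) 1))"
    using tensor_null.additive[of us A B vs]
    by (simp add: tensor_rel_def Nil_not_in_keys lookup_add lookup_single diff_diff_eq)
qed

lemma tensor_mscale: "tensor (us @ mscale c A # vs) = pol_scale c (tensor (us @ A # vs))"
proof transfer
  fix us vs :: "'a cmat list" and A :: "'a cmat" and c
  show "tensor_rel (if us @ mscale c A # vs = [] then 0 else Poly_Mapping.single (us @ mscale c A # vs) 1)
      (Poly_Mapping.map ((*) c) (if us @ A # vs = [] then 0 else Poly_Mapping.single (us @ A # vs) 1))"
    using tensor_null.homogeneous[of us c A vs]
    by (simp add: tensor_rel_def Nil_not_in_keys map_scale_single lookup_single)
qed

lemma sum_keys_add:
  fixes p q :: "'a \<Rightarrow>\<^sub>0 complex" and f :: "'a \<Rightarrow> complex \<Rightarrow> 'b::comm_monoid_add"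
  assumes "\<And>w. f w 0 = 0" "\<And>w a b. f w (a + b) = f w a + f w b"
  shows "(\<Sum>w\<in>keys (p + q). f w (lookup (p + q) w)) =
    (\<Sum>w\<in>keys p. f w (lookup p w)) + (\<Sum>w\<in>keys q. f w (lookup q w))"
  using assms by (rule setsum_keys_plus_distrib)

lemma sum_keys_uminus:
  fixes p :: "'a \<Rightarrow>\<^sub>0 complex" and f :: "'a \<Rightarrow> complex \<Rightarrow> 'b::ab_group_add"
  assumes "\<And>w. f w 0 = 0" "\<And>w a b. f w (a + b) = f w a + f w b"
  shows "(\<Sum>w\<in>keys (- p). f w (lookup (- p) w)) = - (\<Sum>w\<in>keys p. f w (lookup p w))"
  using sum_keys_add[of f p "- p"] assms by (simp add: eq_neg_iff_add_eq_0 add.commute)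

lemma sum_keys_diff:
  fixes p q :: "'a \<Rightarrow>\<^sub>0 complex" and f :: "'a \<Rightarrow> complex \<Rightarrow> 'b::ab_group_add"
  assumes "\<And>w. f w 0 = 0" "\<And>w a b. f w (a + b) = f w a + f w b"
  shows "(\<Sum>w\<in>keys (p - q). f w (lookup (p - q) w)) =
    (\<Sum>w\<in>keys p. f w (lookup p w)) - (\<Sum>w\<in>keys q. f w (lookup q w))"
  using sum_keys_add[of f p "- q"] sum_keys_uminus[of f q] assms by simp

lemma sum_keys_single:
  fixes f :: "'a \<Rightarrow> complex \<Rightarrow> 'b::comm_monoid_add"
  assumes "\<And>w. f w 0 = 0"
  shows "(\<Sum>w\<in>keys (Poly_Mapping.single v c). f w (lookup (Poly_Mapping.single v c) w)) = f v c"
  using assms by (cases "c = 0") (auto simp: lookup_single)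

lemma sum_keys_scale:
  fixes f :: "'a \<Rightarrow> complex \<Rightarrow> 'b::comm_monoid_add"
  assumes "\<And>w. f w 0 = 0"
  shows "(\<Sum>w\<in>keys (Poly_Mapping.map ((*) c) p). f w (lookup (Poly_Mapping.map ((*) c) p) w)) =
    (\<Sum>w\<in>keys p. f w (c * lookup p w))"
proof (cases "c = 0")
  case True
  then have "Poly_Mapping.map ((*) c) p = 0"
    by (intro poly_mapping_eqI) (simp add: lookup_map_scale)
  with True assms show ?thesis by simp
next
  case False
  then have "keys (Poly_Mapping.map ((*) c) p) = keys p"
    by (auto simp: in_keys_iff lookup_map_scale)
  then show ?thesis by (simp add: lookup_map_scale)
qed

text \<open>
  Every multilinear functional on words factors through the quotient; this is what makes the
  quotient the full tensor power and not something smaller.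
\<close>

definition multilinear :: "('n::finite cmat list \<Rightarrow> complex) \<Rightarrow> bool" where
  "multilinear \<phi> \<longleftrightarrow>
    (\<forall>us A B vs. \<phi> (us @ (A + B) # vs) = \<phi> (us @ A # vs) + \<phi> (us @ B # vs)) \<and>
    (\<forall>us c A vs. \<phi> (us @ mscale c A # vs) = c * \<phi> (us @ A # vs))"

lemma multilinear_tensor_null:
  assumes "p \<in> tensor_null" "multilinear \<phi>"
  shows "(\<Sum>w\<in>keys p. lookup p w * \<phi> w) = 0"
  using assms(1)
proof induction
  case (add p q)
  then show ?case
    by (subst sum_keys_add[of "\<lambda>w c. c * \<phi> w"]) (auto simp: ring_distribs)
next
  case (scale p c)
  have "(\<Sum>w\<in>keys (Poly_Mapping.map ((*) c) p). lookup (Poly_Mapping.map ((*) c) p) w * \<phi> w)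
      = c * (\<Sum>w\<in>keys p. lookup p w * \<phi> w)"
    by (subst sum_keys_scale[of "\<lambda>w c. c * \<phi> w"]) (auto simp: sum_distrib_left mult.assoc)
  with scale show ?case by simp
next
  case (additive us A B vs)
  show ?case
    using assms(2)
    by (simp add: sum_keys_diff[of "\<lambda>w c. c * \<phi> w"] sum_keys_single[of "\<lambda>w c. c * \<phi> w"]
        ring_distribs multilinear_def del: keys_single)
next
  case (homogeneous us c A vs)
  show ?case
    using assms(2)
    by (simp add: sum_keys_diff[of "\<lambda>w c. c * \<phi> w"] sum_keys_single[of "\<lambda>w c. c * \<phi> w"]
        ring_distribs multilinear_def del: keys_single)
qed simp

section \<open>Evaluation\<close>

fun word_eval :: "'n::finite cmat \<Rightarrow> 'n cmat list \<Rightarrow> 'n cmat" where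
  "word_eval X [] = 0"
| "word_eval X [A] = A"
| "word_eval X (A # B # w) = A ** X ** word_eval X (B # w)"

lemma word_eval_Cons: "w \<noteq> [] \<Longrightarrow> word_eval X (A # w) = A ** X ** word_eval X w"
  by (cases w) auto

lemma word_eval_append:
  "u \<noteq> [] \<Longrightarrow> v \<noteq> [] \<Longrightarrow> word_eval X (u @ v) = word_eval X u ** X ** word_eval X v"
  by (induction u rule: induct_list012) (auto simp: word_eval_Cons matrix_mul_assoc)

lemma mscale_mult_left: "mscale c A ** B = mscale c (A ** B)"
  by (simp add: vec_eq_iff matrix_matrix_mult_def sum_distrib_left mult.assoc)

lemma mscale_mult_right: "A ** mscale c B = mscale c (A ** B)"
  by (simp add: vec_eq_iff matrix_matrix_mult_def sum_distrib_left algebra_simps)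

lemma mult_add_left: "(A + B) ** C = A ** C + B ** C" for A B C :: "'n::finite cmat"
  by (simp add: vec_eq_iff matrix_matrix_mult_def ring_distribs sum.distrib)

lemma mult_add_right: "A ** (B + C) = A ** B + A ** C" for A B C :: "'n::finite cmat"
  by (simp add: vec_eq_iff matrix_matrix_mult_def ring_distribs sum.distrib)

lemma word_eval_add:
  "word_eval X (us @ (A + B) # vs) = word_eval X (us @ A # vs) + word_eval X (us @ B # vs)"
proof -
  have *: "word_eval X ((A + B) # vs) = word_eval X (A # vs) + word_eval X (B # vs)"
    by (cases vs) (auto simp: mult_add_left)
  then show ?thesis
    by (cases "us = []") (auto simp: word_eval_append mult_add_right)
qed

lemma word_eval_mscale: "word_eval X (us @ mscale c A # vs) = mscale c (word_eval X (us @ A # vs))"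
proof -
  have *: "word_eval X (mscale c A # vs) = mscale c (word_eval X (A # vs))"
    by (cases vs) (auto simp: mscale_mult_left)
  then show ?thesis
    by (cases "us = []") (auto simp: word_eval_append mscale_mult_right)
qed

lemma sum_nth_nth: "(\<Sum>w\<in>S. f w) $ i $ j = (\<Sum>w\<in>S. f w $ i $ j)"
  by simp

definition formal_eval :: "'n::finite formal \<Rightarrow> 'n cmat \<Rightarrow> 'n cmat" where
  "formal_eval p X = (\<Sum>w\<in>keys p. mscale (lookup p w) (word_eval X w))"

lemma formal_eval_null: "p \<in> tensor_null \<Longrightarrow> formal_eval p X = 0"
proof -
  assume p: "p \<in> tensor_null"
  have "formal_eval p X $ i $ j = 0" for i j
    using multilinear_tensor_null[OF p, of "\<lambda>w. word_eval X w $ i $ j"]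
    by (simp add: formal_eval_def multilinear_def word_eval_add word_eval_mscale)
  then show ?thesis by (simp add: vec_eq_iff)
qed

lemma mscale_simps [simp]: "mscale 0 A = 0" "mscale 1 A = A"
  and mscale_add_left: "mscale (a + b) A = mscale a A + mscale b A"
  and mscale_add_right: "mscale a (A + B) = mscale a A + mscale a B"
  and mscale_mscale: "mscale a (mscale b A) = mscale (a * b) A"
  by (simp_all add: vec_eq_iff ring_distribs mult.assoc)

lemma formal_eval_add: "formal_eval (p + q) X = formal_eval p X + formal_eval q X"
  unfolding formal_eval_def
  by (rule sum_keys_add[of "\<lambda>w c. mscale c (word_eval X w)"]) (auto simp: mscale_add_left)

lemma formal_eval_diff: "formal_eval (p - q) X = formal_eval p X - formal_eval q X"
  unfolding formal_eval_def
  by (rule sum_keys_diff[of "\<lambda>w c. mscale c (word_eval X w)"]) (auto simp: mscale_add_left)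

lift_definition pol_eval :: "'n::finite matpoly \<Rightarrow> 'n cmat \<Rightarrow> 'n cmat" is formal_eval
proof
  fix p q :: "'n formal" and X
  assume "tensor_rel p q"
  then have "formal_eval (p - q) X = 0" by (simp add: tensor_rel_def formal_eval_null)
  then show "formal_eval p X = formal_eval q X" by (simp add: formal_eval_diff)
qed

lemma pol_eval_add: "pol_eval (p + q) X = pol_eval p X + pol_eval q X"
  by transfer (rule formal_eval_add)

lemma pol_eval_scale: "pol_eval (pol_scale c p) X = mscale c (pol_eval p X)"
  by transfer (simp add: formal_eval_def sum_keys_scale[of "\<lambda>w c. mscale c (word_eval _ w)"]
      vec_eq_iff sum_distrib_left mult.assoc)

lemma pol_eval_tensor: "pol_eval (tensor w) X = word_eval X w"
  by transfer (auto simp: formal_eval_def)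

section \<open>Involution\<close>

definition formal_star :: "'n::finite formal \<Rightarrow> 'n formal" where
  "formal_star p = (\<Sum>w\<in>keys p. Poly_Mapping.single (rev (map adj w)) (cnj (lookup p w)))"

lemma formal_star_add: "formal_star (p + q) = formal_star p + formal_star q"
  unfolding formal_star_def
  by (rule sum_keys_add[of "\<lambda>w c. Poly_Mapping.single (rev (map adj w)) (cnj c)"])
    (auto simp: single_add)

lemma formal_star_diff: "formal_star (p - q) = formal_star p - formal_star q"
  unfolding formal_star_def
  by (rule sum_keys_diff[of "\<lambda>w c. Poly_Mapping.single (rev (map adj w)) (cnj c)"])
    (auto simp: single_add)

lemma formal_star_single:
  "formal_star (Poly_Mapping.single w c) = Poly_Mapping.single (rev (map adj w)) (cnj c)"
  unfolding formal_star_def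
  by (rule sum_keys_single[of "\<lambda>w c. Poly_Mapping.single (rev (map adj w)) (cnj c)"]) simp

lemma map_scale_sum:
  fixes f :: "'b \<Rightarrow> 'a \<Rightarrow>\<^sub>0 complex"
  shows "Poly_Mapping.map ((*) c) (\<Sum>x\<in>S. f x) = (\<Sum>x\<in>S. Poly_Mapping.map ((*) c) (f x))"
  by (rule poly_mapping_eqI) (simp add: lookup_map_scale lookup_sum sum_distrib_left)

lemma formal_star_scale:
  "formal_star (Poly_Mapping.map ((*) c) p) = Poly_Mapping.map ((*) (cnj c)) (formal_star p)"
  unfolding formal_star_def
  by (subst sum_keys_scale[of "\<lambda>w c. Poly_Mapping.single (rev (map adj w)) (cnj c)"])
    (auto simp: map_scale_sum map_scale_single)

lemma formal_star_null: "p \<in> tensor_null \<Longrightarrow> formal_star p \<in> tensor_null"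
proof (induction rule: tensor_null.induct)
  case zero
  show ?case by (simp add: formal_star_def tensor_null.zero)
next
  case (add p q)
  then show ?case by (simp add: formal_star_add tensor_null.add)
next
  case (scale p c)
  then show ?case by (simp add: formal_star_scale tensor_null.scale)
next
  case (additive us A B vs)
  then show ?case
    by (simp add: formal_star_diff formal_star_single adj_add tensor_null.additive)
next
  case (homogeneous us c A vs)
  then show ?case
    by (simp add: formal_star_diff formal_star_single adj_mscale tensor_null.homogeneous)
qed

lemma formal_star_Nil: "[] \<notin> keys p \<Longrightarrow> [] \<notin> keys (formal_star p)"
  by (auto simp: Nil_not_in_keys formal_star_def lookup_sum lookup_single when_def
      intro!: sum.neutral)

lift_definition pol_star :: "'n::finite matpoly \<Rightarrow> 'n matpoly" is formal_star
  by (auto simp: tensor_rel_def formal_star_Nil simp flip: formal_star_diff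
      intro: formal_star_null)

definition self_adjoint :: "'n::finite matpoly \<Rightarrow> bool" where
  "self_adjoint p \<longleftrightarrow> pol_star p = p"

lemma formal_rel_refl: "[] \<notin> keys p \<Longrightarrow> tensor_rel p p"
  by (simp add: tensor_rel_def tensor_null.zero)

lemma pol_star_add: "pol_star (p + q) = pol_star p + pol_star q"
  by transfer (auto simp: tensor_rel_def formal_star_add Nil_not_in_keys lookup_add
      formal_star_Nil[unfolded Nil_not_in_keys] tensor_null.zero)

lemma pol_star_scale: "pol_star (pol_scale c p) = pol_scale (cnj c) (pol_star p)"
  by transfer (auto simp: tensor_rel_def formal_star_scale Nil_not_in_keys lookup_map_scale
      formal_star_Nil[unfolded Nil_not_in_keys] tensor_null.zero)

lemma pol_star_tensor: "pol_star (tensor w) = tensor (rev (map adj w))"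
  by transfer (auto simp: tensor_rel_def formal_star_single tensor_null.zero formal_star_def)

lemma word_eval_rev_adj: "word_eval (adj X) (rev (map adj w)) = adj (word_eval X w)"
proof (induction w rule: induct_list012)
  case 1
  show ?case by (simp add: vec_eq_iff)
next
  case (3 A B w)
  then show ?case
    by (simp add: word_eval_append[of "_ @ _"] adj_mult matrix_mul_assoc del: append_assoc)
qed simp

lemma formal_eval_sum: "formal_eval (\<Sum>x\<in>S. f x) X = (\<Sum>x\<in>S. formal_eval (f x) X)"
  by (induction S rule: infinite_finite_induct) (auto simp: formal_eval_add formal_eval_def[of 0])

lemma formal_eval_single: "formal_eval (Poly_Mapping.single w c) X = mscale c (word_eval X w)"
  unfolding formal_eval_def
  by (rule sum_keys_single[of "\<lambda>w c. mscale c (word_eval X w)"]) simp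

lemma adj_pol_eval: "adj (pol_eval p X) = pol_eval (pol_star p) (adj X)"
  by transfer (simp add: formal_star_def formal_eval_sum formal_eval_single word_eval_rev_adj
      flip: adj_mscale, simp add: formal_eval_def vec_eq_iff)

section \<open>Homogeneous components and degree\<close>

definition formal_component :: "nat \<Rightarrow> 'n::finite formal \<Rightarrow> 'n formal" where
  "formal_component d p =
    (\<Sum>w\<in>keys p. if length w = Suc d then Poly_Mapping.single w (lookup p w) else 0)"

lemma lookup_formal_component:
  "lookup (formal_component d p) w = (if length w = Suc d then lookup p w else 0)"
proof -
  have "lookup (formal_component d p) w =
      (\<Sum>v\<in>keys p. if v = w then (if length w = Suc d then lookup p w else 0) else 0)"
    unfolding formal_component_def lookup_sum
    by (rule sum.cong) (auto simp: lookup_single)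
  then show ?thesis by (auto simp: in_keys_iff)
qed

lemma formal_component_diff:
  "formal_component d (p - q) = formal_component d p - formal_component d q"
  by (rule poly_mapping_eqI) (simp add: lookup_formal_component lookup_minus)

lemma formal_component_add:
  "formal_component d (p + q) = formal_component d p + formal_component d q"
  by (rule poly_mapping_eqI) (simp add: lookup_formal_component lookup_add)

lemma formal_component_scale:
  "formal_component d (Poly_Mapping.map ((*) c) p) = Poly_Mapping.map ((*) c) (formal_component d p)"
  by (rule poly_mapping_eqI) (simp add: lookup_formal_component lookup_map_scale)

lemma formal_component_single:
  "formal_component d (Poly_Mapping.single w c) =
    (if length w = Suc d then Poly_Mapping.single w c else 0)"
  by (rule poly_mapping_eqI) (auto simp: lookup_formal_component lookup_single when_def)

lemma formal_component_null: "p \<in> tensor_null \<Longrightarrow> formal_component d p \<in> tensor_null"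
proof (induction rule: tensor_null.induct)
  case zero
  show ?case by (simp add: formal_component_def tensor_null.zero)
next
  case (add p q)
  then show ?case by (simp add: formal_component_add tensor_null.add)
next
  case (scale p c)
  then show ?case by (simp add: formal_component_scale tensor_null.scale)
next
  case (additive us A B vs)
  then show ?case
    by (simp add: formal_component_diff formal_component_single tensor_null.additive
        tensor_null.zero)
next
  case (homogeneous us c A vs)
  then show ?case
    by (simp add: formal_component_diff formal_component_single tensor_null.homogeneous
        tensor_null.zero)
qed

lift_definition pol_component :: "nat \<Rightarrow> 'n::finite matpoly \<Rightarrow> 'n matpoly" is formal_component
  by (auto simp: tensor_rel_def Nil_not_in_keys lookup_formal_component formal_component_null
      simp flip: formal_component_diff)

lemma pol_component_tensor:
  "pol_component d (tensor w) = (if length w = Suc d then tensor w else 0)"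
  by transfer (auto simp: tensor_rel_def formal_component_single tensor_null.zero
      formal_component_def)

lemma formal_component_sum:
  "formal_component d (\<Sum>x\<in>S. f x) = (\<Sum>x\<in>S. formal_component d (f x))"
  by (rule poly_mapping_eqI) (simp add: lookup_formal_component lookup_sum)

lemma formal_star_sum: "formal_star (\<Sum>x\<in>S. f x) = (\<Sum>x\<in>S. formal_star (f x))"
  by (induction S rule: infinite_finite_induct) (auto simp: formal_star_add formal_star_def[of 0])

lemma formal_star_component: "formal_star (formal_component d p) = formal_component d (formal_star p)"
proof -
  have "formal_star (formal_component d p) = (\<Sum>w\<in>keys p.
      formal_star (if length w = Suc d then Poly_Mapping.single w (lookup p w) else 0))"
    by (simp only: formal_component_def[of d p] formal_star_sum)
  also have "\<dots> = (\<Sum>w\<in>keys p.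
      formal_component d (Poly_Mapping.single (rev (map adj w)) (cnj (lookup p w))))"
    by (intro sum.cong refl)
      (auto simp: formal_star_single formal_component_single formal_star_def[of 0])
  also have "\<dots> = formal_component d (formal_star p)"
    by (simp only: formal_component_sum formal_star_def)
  finally show ?thesis .
qed

lemma pol_star_component: "pol_star (pol_component d p) = pol_component d (pol_star p)"
proof transfer
  fix d and p :: "'a formal" assume "tensor_rel p p"
  then have "[] \<notin> keys (formal_component d (formal_star p))"
    by (simp add: Nil_not_in_keys lookup_formal_component)
  then show "tensor_rel (formal_star (formal_component d p)) (formal_component d (formal_star p))"
    by (simp add: formal_star_component formal_rel_refl)
qed

lemma finite_pol_components: "finite {d. pol_component d p \<noteq> 0}"
proof -
  have "\<exists>N. \<forall>d\<ge>N. pol_component d p = 0"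
  proof transfer
    fix p :: "'a formal" assume "tensor_rel p p"
    define N where "N = Suc (Max (length ` keys p))"
    have "formal_component d p = 0" if "d \<ge> N" for d
    proof -
      have "length w \<noteq> Suc d" if "w \<in> keys p" for w
      proof -
        have "length w \<le> Max (length ` keys p)"
          by (rule Max_ge) (use that in simp_all)
        with \<open>d \<ge> N\<close> show ?thesis by (simp add: N_def)
      qed
      then show ?thesis
        unfolding formal_component_def by (simp cong: sum.cong)
    qed
    then show "\<exists>N. \<forall>d\<ge>N. tensor_rel (formal_component d p) 0"
      by (intro exI[of _ N]) (auto simp: tensor_rel_def tensor_null.zero)
  qed
  then obtain N where "\<forall>d\<ge>N. pol_component d p = 0" ..
  then have "{d. pol_component d p \<noteq> 0} \<subseteq> {..<N}"
    by (auto simp: not_less[symmetric])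
  then show ?thesis by (rule finite_subset) simp
qed

lemma pol_component_sum: "(\<Sum>d | pol_component d p \<noteq> 0. pol_component d p) = p"
proof -
  have sum_cls: "tensor_rel (\<Sum>d<N. formal_component d r) r \<longleftrightarrow> True"
    if "tensor_rel r r" "\<forall>w\<in>keys r. length w \<le> N" for r :: "'a formal" and N
  proof -
    have "(\<Sum>d<N. formal_component d r) = r"
    proof (rule poly_mapping_eqI)
      fix w
      have "lookup (\<Sum>d<N. formal_component d r) w =
          (\<Sum>d<N. if length w = Suc d then lookup r w else 0)"
        by (simp add: lookup_sum lookup_formal_component)
      also have "\<dots> = lookup r w"
      proof (cases "w \<in> keys r")
        case True
        then have "w \<noteq> []" "length w \<le> N" using that by (auto simp: tensor_rel_def)
        then obtain k where "length w = Suc k" "k < N" by (cases w) auto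
        then show ?thesis by simp
      next
        case False
        then show ?thesis by (auto simp: in_keys_iff intro!: sum.neutral)
      qed
      finally show "lookup (\<Sum>d<N. formal_component d r) w = lookup r w" .
    qed
    with that show ?thesis by simp
  qed
  have sum_lift: "abs_matpoly (\<Sum>d<N. formal_component d r) = (\<Sum>d<N. pol_component d (abs_matpoly r))
      \<and> tensor_rel (\<Sum>d<N. formal_component d r) (\<Sum>d<N. formal_component d r)"
    if r: "tensor_rel r r" for r :: "'a formal" and N :: nat
  proof (induction N)
    case 0
    show ?case by (simp add: zero_matpoly_def tensor_rel_def tensor_null.zero)
  next
    case (Suc N)
    have c: "tensor_rel (formal_component N r) (formal_component N r)"
      using r by (auto simp: tensor_rel_def Nil_not_in_keys lookup_formal_component)
    with Suc have "tensor_rel ((\<Sum>d<N. formal_component d r) + formal_component N r)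
        ((\<Sum>d<N. formal_component d r) + formal_component N r)"
      by (auto simp: tensor_rel_def Nil_not_in_keys lookup_add)
    with Suc c r show ?case
      by (simp add: plus_matpoly.abs_eq[symmetric] pol_component.abs_eq)
  qed
  obtain r where r: "tensor_rel r r" "p = abs_matpoly r"
    by (metis Quotient_matpoly Quotient_abs_rep Quotient_rep_reflp)
  define N where "N = Max (insert 0 (length ` keys r))"
  obtain M where M: "{d. pol_component d p \<noteq> 0} \<subseteq> {..<M}"
    using finite_nat_bounded[OF finite_pol_components] by blast
  define K where "K = max N M"
  have "\<forall>w\<in>keys r. length w \<le> K"
    unfolding K_def N_def by (auto simp: le_max_iff_disj)
  with r sum_cls have rel: "tensor_rel (\<Sum>d<K. formal_component d r) r" by blast
  have "p = (\<Sum>d<K. pol_component d p)"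
    using sum_lift[OF r(1), of K] rel r(2) by (metis Quotient_matpoly Quotient_rel_abs)
  also have "\<dots> = (\<Sum>d | pol_component d p \<noteq> 0. pol_component d p)"
    by (rule sum.mono_neutral_right) (use M in \<open>auto simp: K_def less_max_iff_disj\<close>)
  finally show ?thesis by simp
qed

definition pol_degree :: "'n::finite matpoly \<Rightarrow> ereal" where
  "pol_degree p = (if p = 0 then - \<infinity> else ereal (real (Max {d. pol_component d p \<noteq> 0})))"

lemma pol_degree_eq_iff:
  "pol_degree p = ereal (real d) \<longleftrightarrow>
    pol_component d p \<noteq> 0 \<and> (\<forall>k>d. pol_component k p = 0)"
proof -
  have z: "pol_component k 0 = (0 :: 'a matpoly)" for k
    by transfer (simp add: tensor_rel_def formal_component_def tensor_null.zero)
  show ?thesis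
  proof (cases "p = 0")
    case True
    then show ?thesis by (simp add: pol_degree_def z)
  next
    case False
    then have ne: "{d. pol_component d p \<noteq> 0} \<noteq> {}"
      using pol_component_sum[of p] by (metis sum.empty)
    show ?thesis
      using False Max_eq_iff[OF finite_pol_components ne, of d]
      by (auto simp: pol_degree_def not_le[symmetric])
  qed
qed

text \<open>
  The notion is meant for self-adjoint homogeneous \<open>q\<close>. The components of a
  self-adjoint polynomial are such, by \<open>pol_star_component\<close>.
\<close>

definition nondegenerate :: "'n::finite matpoly \<Rightarrow> bool" where
  "nondegenerate q \<longleftrightarrow> (\<forall>X. hermitian X \<longrightarrow> pol_eval q X = 0 \<longrightarrow> X = 0)"

end

theory Submission
  imports Defs "HOL-Library.Multiset" "HOL-Library.Function_Algebras" "Jordan_Normal_Form.Char_Poly"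
begin

text \<open>
  Homogenising \<open>p\<close> with an extra real variable \<open>t\<close> and reading off the
  \<open>n\<^sup>2\<close> real coordinates of its (Hermitian) value gives \<open>n\<^sup>2\<close> real forms of odd
  degree \<open>d\<close> in \<open>n\<^sup>2 + 1\<close> real variables. Such a system has a common nontrivial real zero (the
  polynomial Borsuk-Ulam theorem). At this zero \<open>t \<noteq> 0\<close>, because \<open>t = 0\<close> would make it a zero of
  the leading form; dividing by \<open>t\<close> yields a zero of \<open>p\<close>.

  The polynomial Borsuk-Ulam theorem is proved algebraically. Let \<open>f\<^sub>1, \<dots>, f\<^sub>N\<close> be odd polynomials in
  \<open>x\<^sub>0, \<dots>, x\<^sub>N\<close> and \<open>D\<close> an odd number exceeding their degrees. For real \<open>s\<close> the relations
  \<open>x\<^sub>j\<^sup>D = s f\<^sub>j\<close> (\<open>j \<ge> 1\<close>) and \<open>x\<^sub>0\<^sup>2\<^sup>D = 1 - (x\<^sub>1\<^sup>2 + \<dots> + x\<^sub>N\<^sup>2)\<close> express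
  powers of distinct variables by terms of lower degree, so the monomials with exponents below those
  powers form a basis of the quotient algebra. Since the relations respect the parity of the degree,
  the monomials of even degree among them form a basis of the even part, which has the odd dimension
  \<open>D\<^sup>N\<^sup>+\<^sup>1\<close>. A real commutative algebra of odd dimension has a real character, and this one is
  evaluation at a real point. Hence the relations have a real solution for every \<open>s\<close>; all these
  solutions lie on one compact set, and a limit for \<open>s \<rightarrow> \<infinity>\<close> is a common zero of the \<open>f\<^sub>j\<close>.
\<close>

no_notation Matrix.vec_index (infixl "$" 100)

section \<open>Common eigenvectors in odd dimension\<close>

lemma odd_degree_real_root:
  fixes p :: "real poly"
  assumes "odd (degree p)"
  shows "\<exists>x. poly p x = 0"
proof -
  have *: "\<exists>x. poly q x = 0" if odd: "odd (degree q)" and pos: "lead_coeff q > 0" for q :: "real poly"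
  proof -
    obtain a where a: "\<And>x. x \<ge> a \<Longrightarrow> lead_coeff q \<le> poly q x"
      using poly_pinfty_gt_lc[OF pos] by blast
    \<comment> \<open>Since the degree is odd, \<open>- q(- x)\<close> has the same leading
      coefficient as \<open>q\<close>, so \<open>q\<close> is negative far to the left.\<close>
    define r where "r = - pcompose q [:0, - 1:]"
    have "lead_coeff r = lead_coeff q"
      unfolding r_def lead_coeff_minus using odd by (subst lead_coeff_comp) auto
    then obtain b where b: "\<And>x. x \<ge> b \<Longrightarrow> lead_coeff q \<le> poly r x"
      using poly_pinfty_gt_lc[of r] pos by auto
    define M where "M = max (max a b) 1"
    have "M \<ge> a" "M \<ge> b" by (auto simp: M_def)
    have "poly q M > 0" using a[OF \<open>M \<ge> a\<close>] pos by linarith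
    moreover have "poly q (- M) < 0" using b[OF \<open>M \<ge> b\<close>] pos by (simp add: r_def poly_pcompose)
    moreover have "- M < M" by (simp add: M_def)
    ultimately show ?thesis
      using poly_IVT_pos[of "- M" M q] by blast
  qed
  show ?thesis
  proof (cases "lead_coeff p > 0")
    case False
    then have "lead_coeff (- p) > 0" using assms by (auto simp: not_less less_le)
    with *[of "- p"] assms show ?thesis by auto
  qed (use * assms in blast)
qed

text \<open>The matrix of \<open>T\<close> on \<open>span B\<close> has a characteristic polynomial
  of odd degree, hence a real eigenvalue.\<close>

lemma odd_dim_invariant_eigenvector:
  fixes T :: "'a::real_vector \<Rightarrow> 'a"
  assumes T: "linear T" and B: "finite B" "independent B" "odd (card B)"
    and inv: "\<And>x. x \<in> span B \<Longrightarrow> T x \<in> span B"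
  obtains l x where "x \<in> span B" "x \<noteq> 0" "T x = l *\<^sub>R x"
proof -
  define m where "m = card B"
  obtain b where b: "bij_betw b {..<m} B"
    using ex_bij_betw_nat_finite[OF B(1)] by (auto simp: m_def lessThan_atLeast0)
  have bB: "b i \<in> B" if "i < m" for i using b that by (auto simp: bij_betw_def)
  define A where "A = mat m m (\<lambda>(i, j). representation B (T (b j)) (b i))"
  have A: "A \<in> carrier_mat m m" by (simp add: A_def)
  have "odd (degree (char_poly A))" using degree_monic_char_poly[OF A] B(3) by (simp add: m_def)
  then obtain l where "poly (char_poly A) l = 0" using odd_degree_real_root by blast
  then obtain v where v: "eigenvector A v l"
    using eigenvalue_root_char_poly[OF A] by (auto simp: eigenvalue_def)
  then have vc: "v \<in> carrier_vec m" and v0: "v \<noteq> 0\<^sub>v m" and Av: "A *\<^sub>v v = l \<cdot>\<^sub>v v"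
    using A by (auto simp: eigenvector_def)
  define x where "x = (\<Sum>j<m. vec_index v j *\<^sub>R b j)"
  have xspan: "x \<in> span B"
    unfolding x_def by (intro span_sum span_scale span_base bB) simp
  have Tb: "T (b j) = (\<Sum>i<m. (index_mat A (i, j)) *\<^sub>R b i)" if "j < m" for j
  proof -
    have "T (b j) = (\<Sum>y\<in>B. representation B (T (b j)) y *\<^sub>R y)"
      using sum_representation_eq[OF B(2) inv[OF span_base[OF bB[OF that]]] B(1)] by simp
    also have "\<dots> = (\<Sum>i<m. representation B (T (b j)) (b i) *\<^sub>R b i)"
      by (rule sum.reindex_bij_betw[OF b, symmetric])
    finally show ?thesis using that by (simp add: A_def)
  qed
  have "T x = (\<Sum>j<m. \<Sum>i<m. (vec_index v j * index_mat A (i, j)) *\<^sub>R b i)"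
    by (simp add: x_def linear_sum[OF T] linear_scale[OF T] Tb scaleR_sum_right)
  also have "\<dots> = (\<Sum>i<m. (\<Sum>j<m. index_mat A (i, j) * vec_index v j) *\<^sub>R b i)"
    by (subst sum.swap) (simp add: scaleR_sum_left mult.commute)
  also have "\<dots> = (\<Sum>i<m. vec_index (A *\<^sub>v v) i *\<^sub>R b i)"
    using A vc by (intro sum.cong) (auto simp: scalar_prod_def lessThan_atLeast0)
  also have "\<dots> = l *\<^sub>R x"
    using vc by (simp add: Av x_def scaleR_sum_right)
  finally have Tx: "T x = l *\<^sub>R x" .
  have "x \<noteq> 0"
  proof
    assume "x = 0"
    have "x = (\<Sum>y\<in>B. vec_index v (the_inv_into {..<m} b y) *\<^sub>R y)"
      unfolding x_def using b
      by (subst sum.reindex_bij_betw[OF b, symmetric]) (auto simp: bij_betw_def the_inv_into_f_f)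
    with \<open>x = 0\<close> have "vec_index v (the_inv_into {..<m} b y) = 0" if "y \<in> B" for y
      using independentD[OF B(2,1) subset_refl, of "\<lambda>y. vec_index v (the_inv_into {..<m} b y)"] that
      by metis
    then have "vec_index v i = 0" if "i < m" for i
      using that bB[OF that] b the_inv_into_f_f[of b "{..<m}" i] by (metis bij_betw_def lessThan_iff)
    then show False using vc v0 by (auto intro: eq_vecI)
  qed
  with xspan Tx that show ?thesis by blast
qed

text \<open>Extend a basis of the kernel to a basis of \<open>span B\<close>; \<open>T\<close> is
  injective on the span of the added vectors. Dimensions appear as cardinalities of bases because
  the ambient spaces may be infinite-dimensional.\<close>

lemma rank_nullity_bases:
  fixes T :: "'a::real_vector \<Rightarrow> 'b::real_vector"
  assumes T: "linear T" and B: "finite B" "independent B"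
  obtains K C where "finite K" "independent K" "span K = {x \<in> span B. T x = 0}"
    "finite C" "independent C" "span C = T ` span B" "card K + card C = card B"
proof -
  have subs: "subspace {x \<in> span B. T x = 0}"
    using linear_subspace_kernel[OF T] subspace_inter[OF subspace_span[of B]] by (simp add: Collect_conj_eq)
  obtain K where K: "K \<subseteq> {x \<in> span B. T x = 0}" "independent K" "{x \<in> span B. T x = 0} \<subseteq> span K"
    using maximal_independent_subset by blast
  have spanK: "span K = {x \<in> span B. T x = 0}"
    using K subs by (meson span_minimal subset_antisym)
  obtain D where D: "K \<subseteq> D" "D \<subseteq> span B" "independent D" "span B \<subseteq> span D"
    using maximal_independent_subset_extend[of K "span B"] K by blast
  have spanD: "span D = span B" using D by (metis span_minimal subset_antisym subspace_span)
  have finD: "finite D" "card D \<le> card B"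
    using independent_span_bound[OF B(1) D(3,2)] by auto
  have "card B \<le> card D"
    using independent_span_bound[OF finD(1) B(2)] spanD span_superset by blast
  with finD have cardD: "card D = card B" by simp
  define C where "C = T ` (D - K)"
  \<comment> \<open>Such an \<open>x\<close> also lies in \<open>span K\<close>, so its coordinates
    in \<open>D\<close> are supported both on \<open>K\<close> and on \<open>D - K\<close>.\<close>
  have inj: "x = 0" if x: "x \<in> span (D - K)" and Tx: "T x = 0" for x
  proof -
    have "x \<in> span K" using x Tx spanK spanD span_mono[of "D - K" D] by auto
    have "representation D x = representation K x"
      using representation_extend[OF D(3) \<open>x \<in> span K\<close> D(1)] .
    moreover have "representation D x = representation (D - K) x"
      using representation_extend[OF D(3) x] by blast
    ultimately have "representation D x y = 0" for y
      using representation_ne_zero by (metis DiffE)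
    moreover have "x \<in> span D" using \<open>x \<in> span K\<close> span_mono[OF D(1)] by blast
    ultimately show ?thesis
      using sum_nonzero_representation_eq[OF D(3)] by force
  qed
  have injon: "inj_on T (span (D - K))"
    using inj linear_injective_on_subspace_0[OF T subspace_span] by blast
  have "independent C"
    unfolding C_def
    by (rule linear_independent_injective_image[OF T _ injon])
      (use D(3) independent_mono in blast)
  moreover have "span C = T ` span B"
  proof -
    have "span C = T ` span (D - K)" by (simp add: C_def linear_span_image[OF T])
    also have "\<dots> = T ` span B"
    proof
      show "T ` span (D - K) \<subseteq> T ` span B" using spanD span_mono[of "D - K" D] by auto
      show "T ` span B \<subseteq> T ` span (D - K)"
      proof
        fix y assume "y \<in> T ` span B"
        then obtain x where "x \<in> span (K \<union> (D - K))" "y = T x"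
          using spanD D(1) by (metis Un_Diff_cancel imageE sup.absorb2)
        then obtain u w where "u \<in> span K" "w \<in> span (D - K)" "y = T (u + w)"
          unfolding span_Un by blast
        then show "y \<in> T ` span (D - K)" using spanK by (auto simp: linear_add[OF T])
      qed
    qed
    finally show ?thesis .
  qed
  moreover have "card C = card (D - K)"
    unfolding C_def by (rule card_image) (meson injon inj_on_subset span_superset)
  then have "card K + card C = card B"
    using D(1) finD(1) cardD by (metis card_Diff_subset card_mono finite_subset le_add_diff_inverse)
  ultimately show ?thesis
    using that[of K C] K(2) spanK finD D(1) by (auto simp: C_def intro: finite_subset)
qed

text \<open>
  On an invariant subspace of minimal odd dimension every operator \<open>T\<close> of the family is scalar: for an
  eigenvalue \<open>l\<close> of \<open>T\<close> the kernel and the image of \<open>T - l\<close> are invariant, and one of them has odd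
  dimension.
\<close>

lemma common_eigenvector_odd_dim:
  fixes F :: "('a::real_vector \<Rightarrow> 'a) set"
  assumes B: "finite B" "independent B" "odd (card B)"
    and lin: "\<And>T. T \<in> F \<Longrightarrow> linear T"
    and inv: "\<And>T x. T \<in> F \<Longrightarrow> x \<in> span B \<Longrightarrow> T x \<in> span B"
    and comm: "\<And>T U x. T \<in> F \<Longrightarrow> U \<in> F \<Longrightarrow> T (U x) = U (T x)"
  obtains x where "x \<in> span B" "x \<noteq> 0" "\<And>T. T \<in> F \<Longrightarrow> \<exists>l. T x = l *\<^sub>R x"
proof -
  define P where "P m \<longleftrightarrow> (\<exists>C. finite C \<and> independent C \<and> card C = m \<and> odd m \<and> span C \<subseteq> span B \<and>
      (\<forall>T\<in>F. \<forall>x\<in>span C. T x \<in> span C))" for m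
  define m where "m = (LEAST m. P m)"
  have "P (card B)" unfolding P_def using B inv by blast
  then have "P m" unfolding m_def by (rule LeastI)
  have least: "m \<le> k" if "P k" for k
    using that unfolding m_def by (rule Least_le)
  from \<open>P m\<close> obtain C where C: "finite C" "independent C" "card C = m" "odd m" "span C \<subseteq> span B"
    and invC: "\<And>T x. T \<in> F \<Longrightarrow> x \<in> span C \<Longrightarrow> T x \<in> span C"
    unfolding P_def by blast
  have scalar: "\<exists>l. \<forall>x\<in>span C. T x = l *\<^sub>R x" if T: "T \<in> F" for T
  proof -
    obtain l x where x: "x \<in> span C" "x \<noteq> 0" "T x = l *\<^sub>R x"
      by (rule odd_dim_invariant_eigenvector[OF lin[OF T] C(1,2)]) (use C(3,4) invC[OF T] in auto)
    define U where "U y = T y - l *\<^sub>R y" for y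
    have linU: "linear U"
      unfolding U_def by (intro linear_compose_sub lin T linear_scale_self)
    have commU: "U (V y) = V (U y)" if "V \<in> F" for V y
      using comm[OF T that] lin[OF that] by (simp add: U_def linear_diff linear_scale)
    have Uspan: "U y \<in> span C" if "y \<in> span C" for y
      using that by (simp add: U_def invC T span_diff span_scale)
    obtain K D where K: "finite K" "independent K" "span K = {x \<in> span C. U x = 0}"
      and D: "finite D" "independent D" "span D = U ` span C" and card: "card K + card D = m"
      by (rule rank_nullity_bases[OF linU C(1,2)]) (use C(3) in auto)
    have invK: "V y \<in> span K" if "V \<in> F" "y \<in> span K" for V y
      using that lin[OF that(1)] by (auto simp: K(3) commU invC linear_0)
    have invD: "V y \<in> span D" if "V \<in> F" "y \<in> span D" for V y
      using that by (auto simp: D(3) invC simp flip: commU)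
    \<comment> \<open>If the kernel has odd dimension, minimality makes it all of
      \<open>span C\<close>. Otherwise the image has odd dimension, and minimality would make the
      kernel trivial, although it contains \<open>x\<close>.\<close>
    have "D = {}"
    proof (cases "odd (card K)")
      case True
      then have "P (card K)" unfolding P_def using K C(5) invK by blast
      then show ?thesis using least card D(1) by (metis add.right_neutral add_le_cancel_left card_0_eq le_zero_eq)
    next
      case False
      then have "odd (card D)" using card C(4) by auto
      moreover have "span D \<subseteq> span B" using D(3) Uspan C(5) by auto
      ultimately have "P (card D)" unfolding P_def using D invD by blast
      then have "card K = 0" using least card by fastforce
      then have "K = {}" using K(1) by simp
      then show ?thesis using K(3) x by (auto simp: U_def)
    qed
    then have "U y = 0" if "y \<in> span C" for y using D(3) that by auto
    then show ?thesis by (auto simp: U_def intro!: exI[of _ l])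
  qed
  have "C \<noteq> {}" using C by auto
  then obtain x where "x \<in> C" by blast
  then have "x \<noteq> 0" "x \<in> span C" using C(2) dependent_zero span_base by auto
  with scalar C(5) that show ?thesis by blast
qed

section \<open>Functionals vanishing on an ideal of polynomials\<close>

text \<open>Functionals on monomials are to form a real vector space, so that \<open>span\<close>
  and \<open>independent\<close> apply to them.\<close>

instantiation "fun" :: (type, real_vector) real_vector
begin

definition scaleR_fun :: "real \<Rightarrow> ('a \<Rightarrow> 'b) \<Rightarrow> 'a \<Rightarrow> 'b" where
  "scaleR_fun r f = (\<lambda>x. r *\<^sub>R f x)"

instance
  by standard (auto simp: scaleR_fun_def fun_eq_iff scaleR_add_right scaleR_add_left)

end

lemma scaleR_fun_apply [simp]: "(r *\<^sub>R f) x = r *\<^sub>R f x"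
  by (simp add: scaleR_fun_def)

lemma sum_fun_apply: "(\<Sum>i\<in>A. f i) x = (\<Sum>i\<in>A. f i x)" for f :: "_ \<Rightarrow> _ \<Rightarrow> _ :: comm_monoid_add"
  by (induction A rule: infinite_finite_induct) auto

text \<open>
  A polynomial is a list of terms, each consisting of a coefficient and a monomial; a monomial is the
  multiset of its variables, so that its degree is its size. A function \<open>c\<close> on monomials is a linear
  functional on polynomials, with value \<open>pair_terms c f\<close> at \<open>f\<close>.
\<close>

type_synonym 'v terms = "(real \<times> 'v multiset) list"

definition eval_monomial :: "('v \<Rightarrow> real) \<Rightarrow> 'v multiset \<Rightarrow> real" where
  "eval_monomial x \<alpha> = (\<Prod>i\<in>#\<alpha>. x i)"

definition pair_terms :: "('v multiset \<Rightarrow> real) \<Rightarrow> 'v terms \<Rightarrow> real" where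
  "pair_terms c f = (\<Sum>(a, \<beta>)\<leftarrow>f. a * c \<beta>)"

abbreviation eval_terms :: "'v terms \<Rightarrow> ('v \<Rightarrow> real) \<Rightarrow> real" where
  "eval_terms f x \<equiv> pair_terms (eval_monomial x) f"

lemma eval_monomial_simps [simp]:
  "eval_monomial x {#} = 1"
  "eval_monomial x (add_mset i \<alpha>) = x i * eval_monomial x \<alpha>"
  "eval_monomial x (\<alpha> + \<beta>) = eval_monomial x \<alpha> * eval_monomial x \<beta>"
  "eval_monomial x (replicate_mset n i) = x i ^ n"
  by (simp_all add: eval_monomial_def)

lemma pair_terms_simps [simp]:
  "pair_terms c [] = 0"
  "pair_terms c ((a, \<beta>) # f) = a * c \<beta> + pair_terms c f"
  "pair_terms c (f @ f') = pair_terms c f + pair_terms c f'"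
  by (simp_all add: pair_terms_def)

lemma sum_list_swap:
  "(\<Sum>x\<leftarrow>xs. \<Sum>y\<leftarrow>ys. f x y) = (\<Sum>y\<leftarrow>ys. \<Sum>x\<leftarrow>xs. (f x y :: 'a :: comm_monoid_add))"
  by (induction xs) (simp_all add: sum_list_addf)

lemma pair_terms_add: "pair_terms (c + c') f = pair_terms c f + pair_terms c' f"
  by (induction f) (auto simp: pair_terms_def ring_distribs)

lemma pair_terms_scale: "pair_terms (r *\<^sub>R c) f = r * pair_terms c f"
  by (induction f) (auto simp: pair_terms_def ring_distribs)

lemma pair_terms_zero: "pair_terms (\<lambda>\<beta>. 0) f = 0"
  by (induction f) (auto simp: pair_terms_def)

text \<open>This lets two reductions at different variables change places in
  \<open>extend_reduce\<close>.\<close>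

lemma pair_terms_swap:
  "pair_terms (\<lambda>\<beta>. pair_terms (\<lambda>\<gamma>. c \<beta> \<gamma>) g) f = pair_terms (\<lambda>\<gamma>. pair_terms (\<lambda>\<beta>. c \<beta> \<gamma>) f) g"
proof -
  have "pair_terms (\<lambda>\<beta>. pair_terms (\<lambda>\<gamma>. c \<beta> \<gamma>) g) f
      = (\<Sum>x\<leftarrow>f. \<Sum>y\<leftarrow>g. fst x * (fst y * c (snd x) (snd y)))"
    by (simp add: pair_terms_def case_prod_unfold sum_list_const_mult)
  also have "\<dots> = (\<Sum>y\<leftarrow>g. \<Sum>x\<leftarrow>f. fst y * (fst x * c (snd x) (snd y)))"
    by (subst sum_list_swap) (simp add: mult.left_commute)
  also have "\<dots> = pair_terms (\<lambda>\<gamma>. pair_terms (\<lambda>\<beta>. c \<beta> \<gamma>) f) g"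
    by (simp add: pair_terms_def case_prod_unfold sum_list_const_mult)
  finally show ?thesis .
qed

lemma pair_terms_cong:
  assumes "\<And>a \<beta>. (a, \<beta>) \<in> set f \<Longrightarrow> c \<beta> = c' \<beta>"
  shows "pair_terms c f = pair_terms c' f"
  unfolding pair_terms_def by (rule arg_cong[of _ _ sum_list], rule map_cong) (use assms in auto)

text \<open>
  The polynomials \<open>x\<^sub>j^(e j) - g j\<close> generate the ideal. Instead of the quotient algebra we use its dual,
  the functionals vanishing on the ideal: multiplication by a monomial becomes a shift, so the operators
  commute for trivial reasons. Only functionals living on the even part are admitted.
\<close>

locale reduction =
  fixes e :: "'v::finite \<Rightarrow> nat" and g :: "'v \<Rightarrow> 'v terms"
  assumes e_pos: "e j > 0"
    and size_less: "(a, \<beta>) \<in> set (g j) \<Longrightarrow> size \<beta> < e j"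
    and size_parity: "(a, \<beta>) \<in> set (g j) \<Longrightarrow> even (size \<beta>) \<longleftrightarrow> even (e j)"
begin

text \<open>The first condition says that \<open>c\<close> kills all monomial multiples of the
  generators; these span the ideal.\<close>

definition ideal_annihilator :: "('v multiset \<Rightarrow> real) set" where
  "ideal_annihilator = {c. (\<forall>\<alpha> j. c (\<alpha> + replicate_mset (e j) j) = pair_terms (\<lambda>\<beta>. c (\<alpha> + \<beta>)) (g j)) \<and>
     (\<forall>\<alpha>. odd (size \<alpha>) \<longrightarrow> c \<alpha> = 0)}"

text \<open>These are the irreducible monomials of even degree, which will index a basis of
  \<open>ideal_annihilator\<close>.\<close>

definition box :: "'v multiset set" where
  "box = {\<alpha>. (\<forall>j. count \<alpha> j < e j) \<and> even (size \<alpha>)}"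

definition reducer :: "'v multiset \<Rightarrow> 'v" where
  "reducer \<alpha> = (SOME j. e j \<le> count \<alpha> j)"

text \<open>
  The value on a monomial outside the box is found by reducing with an arbitrary applicable relation;
  \<open>extend_reduce\<close> shows that the choice does not matter.
\<close>

function extend :: "('v multiset \<Rightarrow> real) \<Rightarrow> 'v multiset \<Rightarrow> real" where
  "extend c0 \<alpha> = (if \<exists>j. e j \<le> count \<alpha> j
     then (\<Sum>(a, \<beta>)\<leftarrow>g (reducer \<alpha>). a * extend c0 (\<alpha> - replicate_mset (e (reducer \<alpha>)) (reducer \<alpha>) + \<beta>))
     else c0 \<alpha>)"
  by pat_completeness auto

lemma reducer: "\<exists>j. e j \<le> count \<alpha> j \<Longrightarrow> e (reducer \<alpha>) \<le> count \<alpha> (reducer \<alpha>)"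
  unfolding reducer_def by (rule someI_ex)

termination
proof (relation "Wellfounded.measure (\<lambda>(c0, \<alpha>). size \<alpha>)")
  fix c0 :: "'v multiset \<Rightarrow> real" and \<alpha> :: "'v multiset" and x :: "real \<times> 'v multiset" and a \<beta>
  assume "\<exists>j. e j \<le> count \<alpha> j" and x: "x \<in> set (g (reducer \<alpha>))" "(a, \<beta>) = x"
  let ?j = "reducer \<alpha>"
  have "replicate_mset (e ?j) ?j \<subseteq># \<alpha>"
    using reducer[OF \<open>\<exists>j. e j \<le> count \<alpha> j\<close>] by (simp add: count_le_replicate_mset_subset_eq)
  then obtain \<alpha>' where \<alpha>': "\<alpha> = replicate_mset (e ?j) ?j + \<alpha>'"
    by (metis mset_subset_eq_exists_conv)
  have "size (\<alpha> - replicate_mset (e ?j) ?j + \<beta>) = size \<alpha>' + size \<beta>"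
    by (subst \<alpha>') simp
  also have "\<dots> < size \<alpha>"
    using size_less[of a \<beta> ?j] x by (subst \<alpha>') auto
  finally show "((c0, \<alpha> - replicate_mset (e ?j) ?j + \<beta>), (c0, \<alpha>)) \<in> Wellfounded.measure (\<lambda>(c0, \<alpha>). size \<alpha>)"
    by simp
qed simp

declare extend.simps [simp del]

section \<open>Confluence of the reduction\<close>

lemma extend_box: "\<forall>j. count \<alpha> j < e j \<Longrightarrow> extend c0 \<alpha> = c0 \<alpha>"
  by (subst extend.simps) (simp flip: not_less)

text \<open>The powers being replaced belong to distinct variables, so they are coprime. If
  \<open>reducer\<close> picks some \<open>i\<close> other than \<open>j\<close>, both powers divide
  the monomial. Each reduction lowers the degree, so by induction the other one may follow it, and
  the order of the two is immaterial.\<close>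

lemma extend_reduce:
  "extend c0 (\<alpha> + replicate_mset (e j) j) = pair_terms (\<lambda>\<beta>. extend c0 (\<alpha> + \<beta>)) (g j)"
proof (induction "size \<alpha> + e j" arbitrary: \<alpha> j rule: less_induct)
  case less
  let ?R = "\<lambda>j. replicate_mset (e j) j"
  define i where "i = reducer (\<alpha> + ?R j)"
  have ex: "\<exists>j'. e j' \<le> count (\<alpha> + ?R j) j'" by (rule exI[of _ j]) simp
  have i: "e i \<le> count (\<alpha> + ?R j) i" using reducer[OF ex] by (simp add: i_def)
  have step: "extend c0 (\<alpha> + ?R j) = pair_terms (\<lambda>\<beta>. extend c0 (\<alpha> + ?R j - ?R i + \<beta>)) (g i)"
    using ex by (subst extend.simps) (simp only: i_def if_True pair_terms_def)
  show ?case
  proof (cases "i = j")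
    case True
    with step show ?thesis by simp
  next
    case False
    then have "?R i \<subseteq># \<alpha>" using i by (simp add: count_le_replicate_mset_subset_eq)
    then obtain \<alpha>' where \<alpha>': "\<alpha> = \<alpha>' + ?R i"
      by (metis mset_subset_eq_exists_conv add.commute)
    have "\<alpha> + ?R j - ?R i + \<beta> = (\<alpha>' + \<beta>) + ?R j" for \<beta>
    proof -
      have "\<alpha> + ?R j = (\<alpha>' + ?R j) + ?R i" by (simp add: \<alpha>')
      then show ?thesis by (simp only: add_diff_cancel_right') simp
    qed
    then have "extend c0 (\<alpha> + ?R j) = pair_terms (\<lambda>\<beta>. extend c0 ((\<alpha>' + \<beta>) + ?R j)) (g i)"
      by (simp only: step)
    also have "\<dots> = pair_terms (\<lambda>\<beta>. pair_terms (\<lambda>\<gamma>. extend c0 (\<alpha>' + \<beta> + \<gamma>)) (g j)) (g i)"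
      by (intro pair_terms_cong less) (use size_less in \<open>fastforce simp: \<alpha>'\<close>)
    also have "\<dots> = pair_terms (\<lambda>\<gamma>. pair_terms (\<lambda>\<beta>. extend c0 ((\<alpha>' + \<gamma>) + \<beta>)) (g i)) (g j)"
      by (subst pair_terms_swap) (simp add: ac_simps)
    also have "\<dots> = pair_terms (\<lambda>\<gamma>. extend c0 ((\<alpha>' + \<gamma>) + ?R i)) (g j)"
      by (intro pair_terms_cong less[symmetric]) (use size_less in \<open>fastforce simp: \<alpha>'\<close>)
    finally show ?thesis by (simp add: \<alpha>' ac_simps)
  qed
qed

text \<open>Reduction preserves the parity of the degree, by \<open>size_parity\<close>.\<close>

lemma extend_odd:
  assumes "\<And>\<alpha>. odd (size \<alpha>) \<Longrightarrow> c0 \<alpha> = 0"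
  shows "odd (size \<alpha>) \<Longrightarrow> extend c0 \<alpha> = 0"
proof (induction "size \<alpha>" arbitrary: \<alpha> rule: less_induct)
  case less
  show ?case
  proof (cases "\<exists>j. e j \<le> count \<alpha> j")
    case True
    then obtain j where "replicate_mset (e j) j \<subseteq># \<alpha>"
      by (auto simp: count_le_replicate_mset_subset_eq)
    then obtain \<alpha>' where \<alpha>': "\<alpha> = \<alpha>' + replicate_mset (e j) j"
      by (metis mset_subset_eq_exists_conv add.commute)
    have "extend c0 (\<alpha>' + \<beta>) = 0" if "(a, \<beta>) \<in> set (g j)" for a \<beta>
      using size_less[OF that] size_parity[OF that] less.prems by (intro less) (auto simp: \<alpha>')
    then show ?thesis
      unfolding \<alpha>' extend_reduce using pair_terms_cong[of "g j" _ "\<lambda>\<beta>. 0"] pair_terms_zero by metis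
  next
    case False
    then show ?thesis using assms less.prems by (simp add: extend_box not_le)
  qed
qed

lemma annihilator_extend:
  assumes "\<And>\<alpha>. odd (size \<alpha>) \<Longrightarrow> c0 \<alpha> = 0"
  shows "extend c0 \<in> ideal_annihilator"
  using extend_reduce extend_odd[of c0] assms by (simp add: ideal_annihilator_def)

text \<open>Repeated reduction expresses every value of \<open>c\<close> through its values on
  \<open>box\<close>.\<close>

lemma annihilator_eq_0:
  assumes c: "c \<in> ideal_annihilator" and 0: "\<And>\<alpha>. \<alpha> \<in> box \<Longrightarrow> c \<alpha> = 0"
  shows "c \<alpha> = 0"
proof (induction "size \<alpha>" arbitrary: \<alpha> rule: less_induct)
  case less
  show ?case
  proof (cases "\<exists>j. e j \<le> count \<alpha> j")
    case True
    then obtain j where "replicate_mset (e j) j \<subseteq># \<alpha>"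
      by (auto simp: count_le_replicate_mset_subset_eq)
    then obtain \<alpha>' where \<alpha>': "\<alpha> = \<alpha>' + replicate_mset (e j) j"
      by (metis mset_subset_eq_exists_conv add.commute)
    have "c (\<alpha>' + \<beta>) = 0" if "(a, \<beta>) \<in> set (g j)" for a \<beta>
      using size_less[OF that] by (intro less) (auto simp: \<alpha>')
    then have "pair_terms (\<lambda>\<beta>. c (\<alpha>' + \<beta>)) (g j) = 0"
      using pair_terms_cong[of "g j" _ "\<lambda>\<beta>. 0"] pair_terms_zero by metis
    then show ?thesis using c by (auto simp: ideal_annihilator_def \<alpha>')
  next
    case False
    then show ?thesis
      using 0[of \<alpha>] c by (cases "even (size \<alpha>)") (auto simp: box_def ideal_annihilator_def not_le)
  qed
qed

section \<open>Dimension of the annihilator and existence of a character\<close>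

lemma subspace_annihilator: "subspace ideal_annihilator"
  unfolding subspace_def
proof (intro conjI ballI allI)
  show "0 \<in> ideal_annihilator"
    by (simp add: ideal_annihilator_def pair_terms_zero)
next
  fix c c' assume "c \<in> ideal_annihilator" "c' \<in> ideal_annihilator"
  then show "c + c' \<in> ideal_annihilator"
    using pair_terms_add[of "\<lambda>\<beta>. c (_ + \<beta>)" "\<lambda>\<beta>. c' (_ + \<beta>)"]
    by (auto simp: ideal_annihilator_def plus_fun_def)
next
  fix r :: real and c assume "c \<in> ideal_annihilator"
  then show "r *\<^sub>R c \<in> ideal_annihilator"
    using pair_terms_scale[of r "\<lambda>\<beta>. c (_ + \<beta>)"]
    by (auto simp: ideal_annihilator_def scaleR_fun_def)
qed

lemma finite_box: "finite box"
proof (rule inj_on_finite)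
  show "inj_on count box" by (rule inj_onI) (rule multiset_eqI, simp)
  show "count ` box \<subseteq> (\<Pi>\<^sub>E j\<in>UNIV. {..<e j})" by (auto simp: box_def)
qed (simp add: finite_PiE)

text \<open>Extending the indicator functions of the elements of \<open>box\<close> gives the basis
  dual to these monomials.\<close>

lemma annihilator_basis:
  obtains B where "finite B" "independent B" "span B = ideal_annihilator" "card B = card box"
proof -
  define b where "b \<beta> = extend (\<lambda>\<alpha>. if \<alpha> = \<beta> then 1 else 0)" for \<beta>
  have b_box: "b \<beta> \<alpha> = (if \<alpha> = \<beta> then 1 else 0)" if "\<alpha> \<in> box" for \<alpha> \<beta>
    unfolding b_def using that by (subst extend_box) (auto simp: box_def)
  have b_in: "b \<beta> \<in> ideal_annihilator" if "\<beta> \<in> box" for \<beta>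
    unfolding b_def using that by (intro annihilator_extend) (auto simp: box_def)
  have inj: "inj_on b box"
    by (rule inj_onI) (metis b_box zero_neq_one)
  have sum_apply: "(\<Sum>\<beta>\<in>box. u \<beta> *\<^sub>R b \<beta>) \<alpha> = u \<alpha>" if "\<alpha> \<in> box" for u \<alpha>
    using that finite_box by (simp add: sum_fun_apply b_box if_distrib cong: if_cong)
  have "independent (b ` box)"
  proof (rule independent_if_scalars_zero)
    fix f x assume *: "(\<Sum>x\<in>b ` box. f x *\<^sub>R x) = 0" "x \<in> b ` box"
    then obtain \<beta> where "x = b \<beta>" "\<beta> \<in> box" by blast
    then show "f x = 0"
      using sum_apply[of \<beta> "\<lambda>\<beta>. f (b \<beta>)"] * by (simp add: sum.reindex[OF inj])
  qed (simp add: finite_box)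
  moreover have "span (b ` box) = ideal_annihilator"
  proof
    show "span (b ` box) \<subseteq> ideal_annihilator"
      using b_in by (intro span_minimal subspace_annihilator) auto
    show "ideal_annihilator \<subseteq> span (b ` box)"
    proof
      fix c assume c: "c \<in> ideal_annihilator"
      let ?s = "\<Sum>\<beta>\<in>box. c \<beta> *\<^sub>R b \<beta>"
      have s: "?s \<in> span (b ` box)" by (intro span_sum span_scale span_base) auto
      have "c - ?s \<in> ideal_annihilator"
        using c b_in by (intro subspace_diff subspace_sum subspace_scale subspace_annihilator) auto
      then have "(c - ?s) \<alpha> = 0" for \<alpha>
        by (rule annihilator_eq_0) (simp add: sum_apply)
      then have "c - ?s = 0" by (intro ext) (simp only: zero_fun_apply)
      then have "c = ?s" by (simp only: right_minus_eq)
      with s show "c \<in> span (b ` box)" by metis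
    qed
  qed
  ultimately show ?thesis
    using that[of "b ` box"] finite_box inj by (simp add: card_image)
qed

text \<open>Shifts by even monomials are the transposes of multiplications. They commute and
  preserve a space of odd dimension, so they have a common eigenvector; scaled to the value 1 at
  \<open>{#}\<close>, it is multiplicative.\<close>

lemma annihilator_character:
  assumes "odd (card box)"
  obtains c where "c \<in> ideal_annihilator" "c {#} = 1" "\<And>\<alpha> \<beta>. even (size \<beta>) \<Longrightarrow> c (\<alpha> + \<beta>) = c \<alpha> * c \<beta>"
proof -
  obtain B where B: "finite B" "independent B" "span B = ideal_annihilator" "card B = card box"
    by (rule annihilator_basis)
  define shift :: "'v multiset \<Rightarrow> ('v multiset \<Rightarrow> real) \<Rightarrow> 'v multiset \<Rightarrow> real" where
    "shift \<beta> c = (\<lambda>\<alpha>. c (\<alpha> + \<beta>))" for \<beta> c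
  define F where "F = shift ` {\<beta>. even (size \<beta>)}"
  obtain c where c: "c \<in> ideal_annihilator" "c \<noteq> 0" and eig: "\<And>T. T \<in> F \<Longrightarrow> \<exists>l. T c = l *\<^sub>R c"
  proof (rule common_eigenvector_odd_dim[of B F])
    fix T assume "T \<in> F"
    then show "linear T"
      by (auto simp: F_def shift_def fun_eq_iff intro!: linearI)
  next
    fix T c assume "T \<in> F" "c \<in> span B"
    then obtain \<beta> where \<beta>: "T = shift \<beta>" "even (size \<beta>)" and c: "c \<in> ideal_annihilator"
      using B(3) by (auto simp: F_def)
    \<comment> \<open>A shifted relation is again a relation. Evenness of \<open>\<beta>\<close> is
      what preserves the vanishing on odd monomials.\<close>
    have "c (\<alpha> + \<beta> + replicate_mset (e j) j) = pair_terms (\<lambda>\<gamma>. c (\<alpha> + \<beta> + \<gamma>)) (g j)" for \<alpha> j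
      using c by (auto simp: ideal_annihilator_def)
    then show "T c \<in> span B"
      using c \<beta> by (simp add: B(3) ideal_annihilator_def shift_def ac_simps)
  next
    fix T U x assume "T \<in> F" "U \<in> F"
    then show "T (U x) = U (T x)" by (auto simp: F_def shift_def ac_simps)
  qed (use B assms that in auto)
  have l: "\<exists>l. \<forall>\<alpha>. c (\<alpha> + \<beta>) = l * c \<alpha>" if "even (size \<beta>)" for \<beta>
    using eig[of "shift \<beta>"] that by (auto simp: F_def shift_def fun_eq_iff)
  \<comment> \<open>Putting \<open>{#}\<close> for \<open>\<alpha>\<close> in the eigenvalue
    equation identifies the eigenvalue: \<open>l * c {#} = c \<beta>\<close>.\<close>
  have c_mult: "c (\<alpha> + \<beta>) * c {#} = c \<alpha> * c \<beta>" if \<beta>: "even (size \<beta>)" for \<alpha> \<beta>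
    using l[OF \<beta>] by (metis add_0 mult.assoc mult.commute)
  have "c {#} \<noteq> 0"
  proof
    assume "c {#} = 0"
    have "c \<beta> = 0" for \<beta>
    proof (cases "even (size \<beta>)")
      case True
      then obtain k where "\<And>\<alpha>. c (\<alpha> + \<beta>) = k * c \<alpha>" using l by blast
      from this[of "{#}"] \<open>c {#} = 0\<close> show ?thesis by simp
    qed (use c(1) in \<open>simp add: ideal_annihilator_def\<close>)
    then have "c = 0" by (intro ext) simp
    with c(2) show False by simp
  qed
  show ?thesis
  proof (rule that[of "(1 / c {#}) *\<^sub>R c"])
    show "(1 / c {#}) *\<^sub>R c \<in> ideal_annihilator"
      by (intro subspace_scale subspace_annihilator c)
    show "((1 / c {#}) *\<^sub>R c) (\<alpha> + \<beta>) = ((1 / c {#}) *\<^sub>R c) \<alpha> * ((1 / c {#}) *\<^sub>R c) \<beta>"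
      if "even (size \<beta>)" for \<alpha> \<beta>
      using c_mult[OF that, of \<alpha>] \<open>c {#} \<noteq> 0\<close> by (simp add: divide_simps)
  qed (simp add: \<open>c {#} \<noteq> 0\<close>)
qed

end

text \<open>
  A functional that is multiplicative on even monomials determines a point only up to sign. The point is
  read off the products \<open>x\<^sub>l x\<^sub>k\<close>, using a variable \<open>l\<close> whose square has a positive value.
\<close>

lemma character_point:
  assumes c: "c {#} = 1" "\<And>\<alpha> \<beta>. even (size \<beta>) \<Longrightarrow> c (\<alpha> + \<beta>) = (c \<alpha> * c \<beta> :: real)"
    and l: "c {#l, l#} > 0"
  obtains x where "x l > 0" "\<And>\<alpha>. even (size \<alpha>) \<Longrightarrow> c \<alpha> = eval_monomial x \<alpha>"
proof -
  \<comment> \<open>The sign is fixed by taking the positive root; \<open>r\<close> is the future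
    value of \<open>x l\<close>.\<close>
  define r where "r = sqrt (c {#l, l#})"
  define x where "x k = c {#l, k#} / r" for k
  have r: "r > 0" "r * r = c {#l, l#}" using l by (auto simp: r_def)
  have x: "c {#l, k#} = r * x k" for k using r by (simp add: x_def)
  have xl: "x l > 0" using l r by (simp add: x_def)
  have diag: "c (replicate_mset (2 * n) l) = r ^ (2 * n)" for n
  proof (induction n)
    case (Suc n)
    have "c (replicate_mset (2 * n) l + {#l, l#}) = r ^ (2 * n) * (r * r)"
      by (subst c(2)) (auto simp: Suc r)
    then show ?case by (simp add: ac_simps)
  qed (simp add: c)
  \<comment> \<open>Each variable of \<open>\<alpha>\<close> is paired with one copy of
    \<open>l\<close>, so only values on products of two variables enter.\<close>
  have "c (\<alpha> + replicate_mset (size \<alpha>) l) = r ^ size \<alpha> * eval_monomial x \<alpha>" for \<alpha>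
  proof (induction \<alpha>)
    case (add k \<alpha>)
    have "c ((\<alpha> + replicate_mset (size \<alpha>) l) + {#l, k#}) = (r ^ size \<alpha> * eval_monomial x \<alpha>) * (r * x k)"
      by (subst c(2)) (simp_all add: add x)
    then show ?case by (simp add: eval_monomial_def ac_simps)
  qed (simp add: c eval_monomial_def)
  moreover have "c (\<alpha> + replicate_mset (size \<alpha>) l) = c \<alpha> * r ^ size \<alpha>" if "even (size \<alpha>)" for \<alpha>
    using that diag[of "size \<alpha> div 2"] by (subst c(2)) auto
  ultimately have "c \<alpha> = eval_monomial x \<alpha>" if "even (size \<alpha>)" for \<alpha>
    using that r by (metis mult.commute mult_right_cancel power_not_zero less_irrefl)
  with xl that show ?thesis by blast
qed

section \<open>Common zeros of odd real polynomials\<close>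

lemma size_eq_sum_count: "size \<alpha> = (\<Sum>j\<in>UNIV. count \<alpha> j)" for \<alpha> :: "'v::finite multiset"
  unfolding size_multiset_overloaded_eq
  by (rule sum.mono_neutral_left) (auto simp: count_eq_zero_iff)

lemma continuous_on_eval_terms:
  "continuous_on S (\<lambda>x :: real ^ 'v::finite. eval_terms f (($) x))"
proof -
  have "continuous_on S (\<lambda>x. eval_monomial (($) x) \<alpha>)" for \<alpha> :: "'v multiset"
    by (induction \<alpha>) (auto intro!: continuous_intros)
  then show ?thesis
    by (induction f) (auto intro!: continuous_intros)
qed

text \<open>
  Halving the exponent of \<open>i0\<close> loses only its parity, which is determined by the other exponents.
\<close>

lemma card_even_box:
  fixes i0 :: "'v::finite"
  shows "card {\<alpha>. (\<forall>j. count \<alpha> j < (if j = i0 then 2 * D else D)) \<and> even (size \<alpha>)} = D ^ CARD('v)"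
    (is "card ?box = _")
proof -
  define h where "h \<alpha> j = (if j = i0 then count \<alpha> i0 div 2 else count \<alpha> j)" for \<alpha> :: "'v multiset" and j
  have size: "size \<alpha> = count \<alpha> i0 + (\<Sum>j\<in>-{i0}. h \<alpha> j)" for \<alpha>
    unfolding size_eq_sum_count
    by (subst sum.remove[of UNIV i0]) (auto simp: h_def Compl_eq_Diff_UNIV intro!: sum.cong)
  have "bij_betw h ?box (\<Pi>\<^sub>E j\<in>UNIV. {..<D})"
    unfolding bij_betw_def
  proof
    show "inj_on h ?box"
    proof (rule inj_onI, rule multiset_eqI)
      fix \<alpha> \<beta> j assume ev: "\<alpha> \<in> ?box" "\<beta> \<in> ?box" and eq: "h \<alpha> = h \<beta>"
      have "count \<alpha> i0 div 2 = count \<beta> i0 div 2" using fun_cong[OF eq, of i0] by (simp add: h_def)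
      \<comment> \<open>The other exponents agree, and both total degrees are even.\<close>
      moreover have "even (count \<alpha> i0) \<longleftrightarrow> even (count \<beta> i0)" using ev by (auto simp: size eq)
      ultimately have "count \<alpha> i0 = count \<beta> i0" by presburger
      then show "count \<alpha> j = count \<beta> j" using fun_cong[OF eq, of j] by (auto simp: h_def split: if_splits)
    qed
    show "h ` ?box = (\<Pi>\<^sub>E j\<in>UNIV. {..<D})"
    proof
      show "h ` ?box \<subseteq> (\<Pi>\<^sub>E j\<in>UNIV. {..<D})"
      proof
        fix y assume "y \<in> h ` ?box"
        then obtain \<alpha> where y: "y = h \<alpha>" and \<alpha>: "\<And>j. count \<alpha> j < (if j = i0 then 2 * D else D)" by blast
        have "h \<alpha> j < D" for j
          using \<alpha>[of j] by (auto simp: h_def)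
        then show "y \<in> (\<Pi>\<^sub>E j\<in>UNIV. {..<D})" by (auto simp: y)
      qed
      show "(\<Pi>\<^sub>E j\<in>UNIV. {..<D}) \<subseteq> h ` ?box"
      proof
        fix y :: "'v \<Rightarrow> nat" assume "y \<in> (\<Pi>\<^sub>E j\<in>UNIV. {..<D})"
        then have yD: "y j < D" for j by auto
        \<comment> \<open>The remainder modulo 2 makes the total degree even and still keeps the
          exponent of \<open>i0\<close> below \<open>2 * D\<close>.\<close>
        define m where "m j = (if j = i0 then 2 * y i0 + (\<Sum>j\<in>-{i0}. y j) mod 2 else y j)" for j
        define \<alpha> where "\<alpha> = (\<Sum>j\<in>UNIV. replicate_mset (m j) j)"
        have count: "count \<alpha> j = m j" for j by (simp add: \<alpha>_def count_sum)
        have hy: "h \<alpha> = y" by (rule ext) (simp add: h_def count m_def)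
        have "m i0 < 2 * D" using yD[of i0] mod_less_divisor[of 2 "\<Sum>j\<in>-{i0}. y j"] by (simp add: m_def)
        then have "\<alpha> \<in> ?box" using yD by (auto simp: count size hy) (auto simp: m_def)
        with hy show "y \<in> h ` ?box" by blast
      qed
    qed
  qed
  then have "card ?box = card (\<Pi>\<^sub>E j\<in>(UNIV :: 'v set). {..<D})" by (rule bij_betw_same_card)
  then show ?thesis by (simp add: card_PiE)
qed

text \<open>By \<open>card_even_box\<close> the even part has odd dimension
  \<open>D ^ CARD('v)\<close>, so a character exists. The relation at \<open>i0\<close> makes it
  positive on some square, so that it is evaluation at a real point.\<close>

lemma perturbed_common_zero:
  fixes f :: "'v::finite \<Rightarrow> 'v terms" and i0 :: 'v and s :: real
  assumes D: "odd D" "D \<ge> 3"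
    and f: "\<And>j a \<beta>. (a, \<beta>) \<in> set (f j) \<Longrightarrow> odd (size \<beta>) \<and> size \<beta> < D"
  obtains x where "x i0 ^ (2 * D) + (\<Sum>j\<in>-{i0}. (x j)\<^sup>2) = 1"
    "\<And>j. j \<noteq> i0 \<Longrightarrow> x j ^ D = s * eval_terms (f j) x"
proof -
  obtain js where js: "set js = -{i0}" "distinct js" using finite_distinct_list[of "-{i0}"] by auto
  define e where "e j = (if j = i0 then 2 * D else D)" for j
  define g where "g j = (if j = i0 then (1, {#}) # map (\<lambda>i. (-1, {#i, i#})) js
      else map (\<lambda>(a, \<beta>). (s * a, \<beta>)) (f j))" for j
  interpret reduction e g
  proof
    fix j a \<beta> assume *: "(a, \<beta>) \<in> set (g j)"
    show "size \<beta> < e j" using * D f by (auto simp: e_def g_def split: if_splits)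
    show "even (size \<beta>) \<longleftrightarrow> even (e j)" using * D f by (auto simp: e_def g_def split: if_splits)
  qed (use D in \<open>auto simp: e_def\<close>)
  have "card box = D ^ CARD('v)"
    unfolding box_def e_def by (rule card_even_box)
  then obtain c where c: "c \<in> ideal_annihilator" "c {#} = 1"
    and mult: "\<And>\<alpha> \<beta>. even (size \<beta>) \<Longrightarrow> c (\<alpha> + \<beta>) = c \<alpha> * c \<beta>"
    using annihilator_character D(1) by auto
  have rel: "c (\<alpha> + replicate_mset (e j) j) = pair_terms (\<lambda>\<beta>. c (\<alpha> + \<beta>)) (g j)" for \<alpha> j
    using c(1) by (simp add: ideal_annihilator_def)
  have g_i0: "pair_terms c' (g i0) = c' {#} - (\<Sum>i\<in>-{i0}. c' {#i, i#})" for c'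
  proof -
    have "pair_terms c' (map (\<lambda>i. (-1, {#i, i#})) js) = - (\<Sum>i\<leftarrow>js. c' {#i, i#})"
      by (simp add: pair_terms_def comp_def uminus_sum_list_map)
    also have "\<dots> = - (\<Sum>i\<in>-{i0}. c' {#i, i#})"
      using js by (simp add: sum_list_distinct_conv_sum_set)
    finally show ?thesis by (simp add: g_def)
  qed
  have g_j: "pair_terms c' (g j) = s * pair_terms c' (f j)" if "j \<noteq> i0" for c' j
    using that by (simp add: g_def pair_terms_def comp_def case_prod_unfold sum_list_const_mult mult.assoc)
  have pow: "c (replicate_mset (2 * n) i) = c {#i, i#} ^ n" for n i
  proof (induction n)
    case (Suc n)
    have "c (replicate_mset (2 * n) i + {#i, i#}) = c {#i, i#} ^ n * c {#i, i#}"
      by (subst mult) (simp_all add: Suc)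
    then show ?case by (simp add: ac_simps)
  qed (simp add: c)
  have sum1: "c {#i0, i0#} ^ D + (\<Sum>i\<in>-{i0}. c {#i, i#}) = 1"
    using rel[of "{#}" i0] by (simp add: g_i0 e_def pow c)
  \<comment> \<open>Otherwise, \<open>D\<close> being odd, both summands in \<open>sum1\<close>
    would be nonpositive.\<close>
  obtain l where l: "c {#l, l#} > 0"
  proof (rule ccontr)
    assume "\<not> thesis"
    then have neg: "c {#i, i#} \<le> 0" for i using that by (meson not_le)
    then have "c {#i0, i0#} ^ D \<le> 0" using D(1) by (simp add: power_le_zero_eq odd_pos)
    moreover have "(\<Sum>i\<in>-{i0}. c {#i, i#}) \<le> 0" using neg by (intro sum_nonpos)
    ultimately show False using sum1 by linarith
  qed
  obtain x where xl: "x l > 0" and x: "\<And>\<alpha>. even (size \<alpha>) \<Longrightarrow> c \<alpha> = eval_monomial x \<alpha>"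
    using character_point[OF c(2) mult l] by blast
  show ?thesis
  proof (rule that[of x])
    show "x i0 ^ (2 * D) + (\<Sum>j\<in>-{i0}. (x j)\<^sup>2) = 1"
      using sum1 by (simp add: x power2_eq_square power_mult)
    fix j assume j: "j \<noteq> i0"
    \<comment> \<open>The relation at \<open>j\<close> has odd degree, where \<open>c\<close> gives
      no information; it is multiplied by \<open>x l\<close>, which is cancelled at the end.\<close>
    have "x l * x j ^ D = eval_monomial x ({#l#} + replicate_mset D j)" by simp
    also have "\<dots> = c ({#l#} + replicate_mset (e j) j)"
      using D j by (subst x) (auto simp: e_def)
    also have "\<dots> = s * pair_terms (\<lambda>\<beta>. c ({#l#} + \<beta>)) (f j)"
      by (simp only: rel g_j[OF j])
    also have "pair_terms (\<lambda>\<beta>. c ({#l#} + \<beta>)) (f j) = pair_terms (\<lambda>\<beta>. x l * eval_monomial x \<beta>) (f j)"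
      using f by (intro pair_terms_cong) (subst x, auto)
    also have "\<dots> = x l * eval_terms (f j) x"
      using pair_terms_scale[of "x l" "eval_monomial x"] by (simp add: scaleR_fun_def)
    finally show "x j ^ D = s * eval_terms (f j) x"
      using xl by simp
  qed
qed

text \<open>The indices other than \<open>i0\<close> give one equation fewer than there are
  variables, as in the Borsuk-Ulam theorem.\<close>

theorem odd_polynomials_common_zero:
  fixes f :: "'v::finite \<Rightarrow> 'v terms" and i0 :: 'v
  assumes f: "\<And>j a \<beta>. (a, \<beta>) \<in> set (f j) \<Longrightarrow> odd (size \<beta>)"
  obtains x i where "x i \<noteq> 0" "\<And>j. j \<noteq> i0 \<Longrightarrow> eval_terms (f j) x = 0"
proof -
  have "finite (\<Union>j. (size \<circ> snd) ` set (f j))" by simp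
  then obtain n where "\<forall>k\<in>(\<Union>j. (size \<circ> snd) ` set (f j)). k < n"
    by (meson finite_nat_set_iff_bounded)
  then have n: "size \<beta> < n" if "(a, \<beta>) \<in> set (f j)" for j a \<beta> using that by force
  define D where "D = 2 * n + 3"
  have D: "odd D" "D \<ge> 3" "\<And>j a \<beta>. (a, \<beta>) \<in> set (f j) \<Longrightarrow> odd (size \<beta>) \<and> size \<beta> < D"
    using f n by (auto simp: D_def intro: order_less_trans[of _ n])
  define K where "K = {x :: real ^ 'v. x $ i0 ^ (2 * D) + (\<Sum>j\<in>-{i0}. (x $ j)\<^sup>2) = 1}"
  \<comment> \<open>The minimum of this sum of squares on the compact set \<open>K\<close> replaces
    the choice of a convergent subsequence.\<close>
  define \<phi> where "\<phi> x = (\<Sum>j\<in>-{i0}. (eval_terms (f j) (($) x))\<^sup>2)" for x :: "real ^ 'v"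
  have le1: "\<bar>x $ j\<bar> \<le> 1" if "x \<in> K" for x j
  proof (cases "j = i0")
    case True
    have "\<bar>x $ i0\<bar> ^ (2 * D) \<le> 1"
      using that sum_nonneg[of "-{i0}" "\<lambda>j. (x $ j)\<^sup>2"] by (simp add: K_def power_even_abs)
    then show ?thesis using True D(2) power_le_one_iff[of "\<bar>x $ i0\<bar>" "2 * D"] by simp
  next
    case False
    then have "(x $ j)\<^sup>2 \<le> (\<Sum>j\<in>-{i0}. (x $ j)\<^sup>2)" by (intro member_le_sum) auto
    also have "\<dots> \<le> 1" using that zero_le_even_power'[of "x $ i0" D] unfolding K_def mem_Collect_eq by linarith
    finally show ?thesis by (simp add: abs_square_le_1)
  qed
  have "compact K"
    unfolding compact_eq_bounded_closed
  proof
    have "norm x \<le> real CARD('v)" if "x \<in> K" for x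
      using norm_le_l1_cart[of x] sum_mono[of UNIV "\<lambda>j. \<bar>x $ j\<bar>" "\<lambda>j. 1"] le1[OF that] by simp
    then show "bounded K" by (rule boundedI)
    show "closed K" unfolding K_def by (intro closed_Collect_eq continuous_intros)
  qed
  have point: "\<exists>x\<in>K. \<phi> x \<le> real CARD('v) / (real (Suc m))\<^sup>2" for m
  proof -
    obtain x where x: "x i0 ^ (2 * D) + (\<Sum>j\<in>-{i0}. (x j)\<^sup>2) = 1"
      "\<And>j. j \<noteq> i0 \<Longrightarrow> x j ^ D = real (Suc m) * eval_terms (f j) x"
      using perturbed_common_zero[OF D(1,2), of f i0 "real (Suc m)"] D(3) by metis
    define y where "y = (\<chi> j. x j)"
    have y: "($) y = x" by (simp add: y_def fun_eq_iff)
    have yK: "y \<in> K" using x(1) by (simp add: K_def y)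
    \<comment> \<open>The left side of the relation is bounded by 1 on \<open>K\<close>, while the
      factor on the right is \<open>Suc m\<close>.\<close>
    have "(eval_terms (f j) x)\<^sup>2 \<le> 1 / (real (Suc m))\<^sup>2" if "j \<noteq> i0" for j
    proof -
      have "\<bar>x j ^ D\<bar> \<le> 1" using le1[OF yK, of j] by (simp add: y power_abs power_le_one)
      then have "(x j ^ D)\<^sup>2 \<le> 1" by (simp only: abs_square_le_1)
      then show ?thesis
        unfolding x(2)[OF that] power_mult_distrib by (simp add: pos_le_divide_eq mult.commute del: of_nat_Suc)
    qed
    then have "\<phi> y \<le> (\<Sum>j\<in>-{i0}. 1 / (real (Suc m))\<^sup>2)"
      unfolding \<phi>_def y by (intro sum_mono) auto
    also have "\<dots> \<le> real CARD('v) / (real (Suc m))\<^sup>2"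
      using card_mono[of UNIV "-{i0}"] by (simp add: divide_right_mono)
    finally show ?thesis using yK by blast
  qed
  have "continuous_on K \<phi>"
    unfolding \<phi>_def by (intro continuous_intros continuous_on_eval_terms)
  then obtain x where x: "x \<in> K" "\<And>y. y \<in> K \<Longrightarrow> \<phi> x \<le> \<phi> y"
    using continuous_attains_inf[OF \<open>compact K\<close>, of \<phi>] point by blast
  have "\<phi> x \<le> real CARD('v) / real (Suc m)" for m
  proof -
    have "\<phi> x \<le> real CARD('v) / (real (Suc m))\<^sup>2"
      using point[of m] x(2) by (meson order_trans)
    also have "\<dots> \<le> real CARD('v) / real (Suc m)"
      by (intro divide_left_mono) (auto simp: power2_eq_square)
    finally show ?thesis .
  qed
  moreover have "(\<lambda>m. real CARD('v) / real (Suc m)) \<longlonglongrightarrow> 0"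
    by (rule LIMSEQ_Suc[OF lim_const_over_n])
  ultimately have "\<phi> x \<le> 0" by (meson LIMSEQ_le_const)
  then have zero: "eval_terms (f j) (($) x) = 0" if "j \<noteq> i0" for j
    using that sum_nonneg_eq_0_iff[of "-{i0}" "\<lambda>j. (eval_terms (f j) (($) x))\<^sup>2"]
      sum_nonneg[of "-{i0}" "\<lambda>j. (eval_terms (f j) (($) x))\<^sup>2"]
    by (simp add: \<phi>_def)
  \<comment> \<open>The origin does not lie on \<open>K\<close>.\<close>
  obtain i where "x $ i \<noteq> 0"
  proof (rule ccontr)
    assume "\<not> thesis"
    then have "x $ i = 0" for i using that by blast
    with x(1) D(2) show False by (simp add: K_def power_0_left)
  qed
  with zero that show ?thesis by blast
qed

section \<open>Matrix polynomials in real coordinates\<close>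

definition is_form :: "nat \<Rightarrow> (('v \<Rightarrow> real) \<Rightarrow> real) \<Rightarrow> bool" where
  "is_form k F \<longleftrightarrow> (\<exists>f. (\<forall>(a, \<beta>)\<in>set f. size \<beta> = k) \<and> (\<forall>x. F x = eval_terms f x))"

lemma is_form_const: "is_form 0 (\<lambda>x. c)"
  unfolding is_form_def by (intro exI[of _ "[(c, {#})]"]) simp

lemma is_form_var: "is_form 1 (\<lambda>x. x i)"
  unfolding is_form_def by (intro exI[of _ "[(1, {#i#})]"]) simp

lemma is_form_zero: "is_form k (\<lambda>x. 0)"
  unfolding is_form_def by (intro exI[of _ "[]"]) simp

lemma is_form_add:
  assumes "is_form k F" "is_form k G"
  shows "is_form k (\<lambda>x. F x + G x)"
proof -
  obtain f g where "\<forall>(a, \<beta>)\<in>set f. size \<beta> = k" "\<forall>x. F x = eval_terms f x"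
    "\<forall>(a, \<beta>)\<in>set g. size \<beta> = k" "\<forall>x. G x = eval_terms g x"
    using assms by (auto simp: is_form_def)
  then show ?thesis
    unfolding is_form_def by (intro exI[of _ "f @ g"]) auto
qed

lemma is_form_mult:
  assumes "is_form k F" "is_form l G"
  shows "is_form (k + l) (\<lambda>x. F x * G x)"
proof -
  obtain f g where f: "\<forall>(a, \<beta>)\<in>set f. size \<beta> = k" "\<forall>x. F x = eval_terms f x"
    and g: "\<forall>(a, \<beta>)\<in>set g. size \<beta> = l" "\<forall>x. G x = eval_terms g x"
    using assms by (auto simp: is_form_def)
  define fg where "fg = concat (map (\<lambda>(a, \<beta>). map (\<lambda>(b, \<gamma>). (a * b, \<beta> + \<gamma>)) g) f)"
  have "eval_terms fg x = eval_terms f x * eval_terms g x" for x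
  proof -
    have "pair_terms (eval_monomial x) (map (\<lambda>(b, \<gamma>). (a * b, \<beta> + \<gamma>)) g)
        = a * eval_monomial x \<beta> * eval_terms g x" for a \<beta>
      by (induction g) (auto simp: algebra_simps)
    then show ?thesis
      unfolding fg_def by (induction f) (auto simp: algebra_simps)
  qed
  moreover have "\<forall>(a, \<beta>)\<in>set fg. size \<beta> = k + l"
    using f(1) g(1) by (fastforce simp: fg_def)
  ultimately show ?thesis
    using f(2) g(2) unfolding is_form_def by (intro exI[of _ fg]) simp
qed

lemma is_form_uminus: "is_form k F \<Longrightarrow> is_form k (\<lambda>x. - F x)"
  using is_form_mult[OF is_form_const[of "- 1"]] by force

lemma is_form_diff: "is_form k F \<Longrightarrow> is_form k G \<Longrightarrow> is_form k (\<lambda>x. F x - G x)"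
  using is_form_add[OF _ is_form_uminus] by force

lemma is_form_power: "is_form k (\<lambda>x. x i ^ k)"
proof (induction k)
  case 0
  show ?case using is_form_const[of 1] by simp
next
  case (Suc k)
  show ?case using is_form_mult[OF is_form_var[of i] Suc] by simp
qed

definition is_cform :: "nat \<Rightarrow> (('v \<Rightarrow> real) \<Rightarrow> complex) \<Rightarrow> bool" where
  "is_cform k F \<longleftrightarrow> is_form k (\<lambda>x. Re (F x)) \<and> is_form k (\<lambda>x. Im (F x))"

lemma is_cform_const: "is_cform 0 (\<lambda>x. c)"
  by (simp add: is_cform_def is_form_const)

lemma is_cform_add: "is_cform k F \<Longrightarrow> is_cform k G \<Longrightarrow> is_cform k (\<lambda>x. F x + G x)"
  by (simp add: is_cform_def is_form_add)

lemma is_cform_sum: "(\<And>i. i \<in> S \<Longrightarrow> is_cform k (F i)) \<Longrightarrow> is_cform k (\<lambda>x. \<Sum>i\<in>S. F i x)"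
  by (induction S rule: infinite_finite_induct)
    (simp_all add: is_cform_add, simp_all add: is_cform_def is_form_zero)

lemma is_cform_mult: "is_cform k F \<Longrightarrow> is_cform l G \<Longrightarrow> is_cform (k + l) (\<lambda>x. F x * G x)"
  by (simp add: is_cform_def is_form_mult is_form_add is_form_diff)

definition is_mform :: "nat \<Rightarrow> (('v \<Rightarrow> real) \<Rightarrow> 'n::finite cmat) \<Rightarrow> bool" where
  "is_mform k F \<longleftrightarrow> (\<forall>i j. is_cform k (\<lambda>x. F x $ i $ j))"

lemma is_mform_const: "is_mform 0 (\<lambda>x. A)"
  by (simp add: is_mform_def is_cform_const)

lemma is_mform_mult: "is_mform k F \<Longrightarrow> is_mform l G \<Longrightarrow> is_mform (k + l) (\<lambda>x. F x ** G x)"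
  by (simp add: is_mform_def matrix_matrix_mult_def is_cform_sum is_cform_mult)

lemma is_mform_sum: "(\<And>i. i \<in> S \<Longrightarrow> is_mform k (F i)) \<Longrightarrow> is_mform k (\<lambda>x. \<Sum>i\<in>S. F i x)"
  by (simp add: is_mform_def is_cform_sum)

lemma is_mform_mscale:
  "is_cform k c \<Longrightarrow> is_mform l F \<Longrightarrow> is_mform (k + l) (\<lambda>x. mscale (c x) (F x))"
  by (simp add: is_mform_def is_cform_mult)

text \<open>A word of length \<open>k + 1\<close> has \<open>k\<close> gaps, each filled by one
  factor \<open>X\<close>.\<close>

lemma is_mform_word_eval:
  assumes "is_mform 1 X"
  shows "length w = Suc k \<Longrightarrow> is_mform k (\<lambda>x. word_eval (X x) w)"
proof (induction w arbitrary: k rule: induct_list012)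
  case (3 A B w)
  then have "is_mform (0 + 1 + length w) (\<lambda>x. A ** X x ** word_eval (X x) (B # w))"
    by (intro is_mform_mult is_mform_const assms) auto
  with 3 show ?case by simp
qed (simp_all add: is_mform_const)

text \<open>
  This is a linear bijection from real matrices onto Hermitian matrices, with inverse \<open>coordinate\<close>;
  it spares us a choice of an order on the indices.
\<close>

definition hermitian_of :: "('n \<times> 'n \<Rightarrow> real) \<Rightarrow> 'n::finite cmat" where
  "hermitian_of y = (\<chi> i j. Complex ((y (i, j) + y (j, i)) / 2) ((y (i, j) - y (j, i)) / 2))"

definition coordinate :: "'n::finite cmat \<Rightarrow> 'n \<times> 'n \<Rightarrow> real" where
  "coordinate A k = Re (A $ fst k $ snd k) + Im (A $ fst k $ snd k)"

lemma hermitian_hermitian_of: "hermitian (hermitian_of y)"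
  by (simp add: hermitian_def Finite_Cartesian_Product.vec_eq_iff hermitian_of_def complex_eq_iff field_simps)

lemma coordinate_hermitian_of: "coordinate (hermitian_of y) k = y k"
  by (simp add: coordinate_def hermitian_of_def field_simps)

text \<open>The coordinates at \<open>(i, j)\<close> and \<open>(j, i)\<close> are the sum and the
  difference of the real and imaginary parts of one entry.\<close>

lemma hermitian_eq_0:
  assumes "hermitian A" "\<And>k. coordinate A k = 0"
  shows "A = 0"
proof -
  have "A $ i $ j = 0" for i j
  proof -
    have "A $ j $ i = cnj (A $ i $ j)"
      using assms(1) unfolding hermitian_def by (metis adj_nth)
    then show ?thesis
      using assms(2)[of "(i, j)"] assms(2)[of "(j, i)"] by (simp add: coordinate_def complex_eq_iff)
  qed
  then show ?thesis by (simp add: Finite_Cartesian_Product.vec_eq_iff)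
qed

lemma is_mform_hermitian_of: "is_mform 1 (\<lambda>x. hermitian_of (\<lambda>k. x (Some k)))"
proof -
  have "is_form (0 + 1) (\<lambda>x. (1 / 2) * (x (Some k) + x (Some l)))"
    "is_form (0 + 1) (\<lambda>x. (1 / 2) * (x (Some k) - x (Some l)))" for k l :: "'a \<times> 'a"
    by (intro is_form_mult is_form_const is_form_add is_form_diff is_form_var)+
  then show ?thesis
    by (simp add: is_mform_def is_cform_def hermitian_of_def)
qed

section \<open>Evaluation and scaling of homogeneous components\<close>

text \<open>A representative of the class supplies \<open>S\<close> and \<open>c\<close>
  independently of \<open>X\<close>, so later arguments can work with sums of words.\<close>

lemma pol_eval_component:
  "\<exists>S c. (\<forall>w\<in>S. length w = Suc k) \<and>
    (\<forall>X. pol_eval (pol_component k p) X = (\<Sum>w\<in>S. mscale (c w) (word_eval X w)))"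
proof transfer
  fix k and p :: "'a formal"
  show "\<exists>S c. (\<forall>w\<in>S. length w = Suc k) \<and>
      (\<forall>X. formal_eval (formal_component k p) X = (\<Sum>w\<in>S. mscale (c w) (word_eval X w)))"
    by (intro exI[of _ "keys (formal_component k p)"] exI[of _ "lookup (formal_component k p)"])
      (auto simp: formal_eval_def in_keys_iff lookup_formal_component split: if_splits)
qed

lemma mscale_sum: "mscale c (\<Sum>i\<in>S. F i) = (\<Sum>i\<in>S. mscale c (F i))"
  by (simp add: Finite_Cartesian_Product.vec_eq_iff sum_distrib_left)

lemma word_eval_scaled:
  "length w = Suc k \<Longrightarrow> word_eval (mscale r X) w = mscale (r ^ k) (word_eval X w)"
proof (induction w arbitrary: k rule: induct_list012)
  case (3 A B w)
  then show ?case by (cases k) (auto simp: mscale_mult_left mscale_mult_right mscale_mscale mult.commute)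
qed simp_all

lemma pol_eval_component_scaled:
  "pol_eval (pol_component k p) (mscale r X) = mscale (r ^ k) (pol_eval (pol_component k p) X)"
proof -
  obtain S c where "\<forall>w\<in>S. length w = Suc k"
    "\<forall>X. pol_eval (pol_component k p) X = (\<Sum>w\<in>S. mscale (c w) (word_eval X w))"
    using pol_eval_component by blast
  then show ?thesis
    by (simp add: word_eval_scaled mscale_sum mscale_mscale mult.commute)
qed

lemma pol_eval_sum: "pol_eval (\<Sum>i\<in>S. q i) X = (\<Sum>i\<in>S. pol_eval (q i) X)"
proof -
  have "pol_eval (0 :: 'n matpoly) X = 0" for X :: "'n::finite cmat"
    by transfer (simp add: formal_eval_def)
  then show ?thesis
    by (induction S rule: infinite_finite_induct) (auto simp: pol_eval_add)
qed

lemma pol_eval_components: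
  assumes "\<forall>k>d. pol_component k p = 0"
  shows "pol_eval p X = (\<Sum>k\<le>d. pol_eval (pol_component k p) X)"
proof -
  have "p = (\<Sum>k | pol_component k p \<noteq> 0. pol_component k p)" by (rule pol_component_sum[symmetric])
  also have "\<dots> = (\<Sum>k\<le>d. pol_component k p)"
    by (rule sum.mono_neutral_left) (use assms in \<open>auto simp flip: not_less\<close>)
  finally show ?thesis by (metis pol_eval_sum)
qed

lemma hermitian_pol_eval:
  "self_adjoint p \<Longrightarrow> hermitian X \<Longrightarrow> hermitian (pol_eval p X)"
  by (simp add: hermitian_def self_adjoint_def adj_pol_eval)

lemma self_adjoint_component: "self_adjoint p \<Longrightarrow> self_adjoint (pol_component k p)"
  by (simp add: self_adjoint_def pol_star_component)

lemma hermitian_sum: "(\<And>i. i \<in> S \<Longrightarrow> hermitian (F i)) \<Longrightarrow> hermitian (\<Sum>i\<in>S. F i)"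
  by (simp add: hermitian_def Finite_Cartesian_Product.vec_eq_iff)

lemma hermitian_mscale_real: "hermitian A \<Longrightarrow> hermitian (mscale (complex_of_real r) A)"
  by (simp add: hermitian_def adj_mscale)

theorem corollary4:
  fixes p :: "'n::finite matpoly" and d :: nat
  assumes "odd d"
    and "self_adjoint p"
    and "pol_degree p = ereal (real d)"
    and "nondegenerate (pol_component d p)"
  shows "\<exists>X :: complex ^ 'n ^ 'n. hermitian X \<and> pol_eval p X = 0"
proof -
  have p: "pol_eval p X = (\<Sum>k\<le>d. pol_eval (pol_component k p) X)" for X
    using assms(3) by (intro pol_eval_components) (simp add: pol_degree_eq_iff)
  \<comment> \<open>\<open>None\<close> is the homogenising variable, and the \<open>Some k\<close>
    are the real coordinates of a Hermitian matrix.\<close>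
  define Y :: "(('n \<times> 'n) option \<Rightarrow> real) \<Rightarrow> 'n cmat" where
    "Y x = hermitian_of (\<lambda>k. x (Some k))" for x
  define F :: "(('n \<times> 'n) option \<Rightarrow> real) \<Rightarrow> 'n cmat" where
    "F x = (\<Sum>k\<le>d. mscale (complex_of_real (x None ^ (d - k))) (pol_eval (pol_component k p) (Y x)))" for x
  have herm_Y: "hermitian (Y x)" for x by (simp add: Y_def hermitian_hermitian_of)
  have herm_F: "hermitian (F x)" for x
    unfolding F_def
    by (intro hermitian_sum hermitian_mscale_real hermitian_pol_eval self_adjoint_component assms herm_Y)
  have form_Y: "is_mform 1 Y" unfolding Y_def by (rule is_mform_hermitian_of)
  have "is_mform d F"
    unfolding F_def
  proof (rule is_mform_sum)
    fix k assume "k \<in> {..d}"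
    obtain S c where S: "\<forall>w\<in>S. length w = Suc k"
      "\<forall>X. pol_eval (pol_component k p) X = (\<Sum>w\<in>S. mscale (c w) (word_eval X w))"
      using pol_eval_component by blast
    have "is_mform (0 + k) (\<lambda>x. mscale (c w) (word_eval (Y x) w))" if "w \<in> S" for w
      using S(1) that by (intro is_mform_mscale is_cform_const is_mform_word_eval form_Y) simp
    then have "is_mform k (\<lambda>x. pol_eval (pol_component k p) (Y x))"
      by (simp add: S(2) is_mform_sum)
    moreover have "is_cform (d - k) (\<lambda>x. complex_of_real (x (None :: ('n \<times> 'n) option) ^ (d - k)))"
      by (simp add: is_cform_def Im_power_real is_form_power is_form_zero)
    ultimately show "is_mform d (\<lambda>x. mscale (complex_of_real (x None ^ (d - k))) (pol_eval (pol_component k p) (Y x)))"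
      using is_mform_mscale \<open>k \<in> {..d}\<close> by force
  qed
  then have "is_form d (\<lambda>x. coordinate (F x) k)" for k
    by (simp add: is_mform_def is_cform_def coordinate_def is_form_add)
  then have "\<exists>f. \<forall>k. (\<forall>(a, \<beta>)\<in>set (f k). size \<beta> = d) \<and> (\<forall>x. coordinate (F x) k = eval_terms (f k) x)"
    unfolding is_form_def by (intro choice allI)
  then obtain f where f: "\<And>k a \<beta>. (a, \<beta>) \<in> set (f k) \<Longrightarrow> size \<beta> = d"
    "\<And>k x. coordinate (F x) k = eval_terms (f k) x"
    by blast
  \<comment> \<open>The index \<open>None\<close> has no equation; the zero polynomial fills its
    place.\<close>
  define h where "h j = (case j of None \<Rightarrow> [] | Some k \<Rightarrow> f k)" for j
  have "odd (size \<beta>)" if "(a, \<beta>) \<in> set (h j)" for j a \<beta>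
    using that f(1) \<open>odd d\<close> by (auto simp: h_def split: option.splits)
  then obtain x i where x: "x i \<noteq> 0" "\<And>j. j \<noteq> None \<Longrightarrow> eval_terms (h j) x = 0"
    using odd_polynomials_common_zero[of h None] by metis
  have "coordinate (F x) k = 0" for k using x(2)[of "Some k"] by (simp add: f(2) h_def)
  then have F0: "F x = 0" using hermitian_eq_0 herm_F by blast
  define t where "t = x None"
  have "t \<noteq> 0"
  proof
    assume "t = 0"
    \<comment> \<open>At \<open>t = 0\<close> the factor \<open>t ^ (d - k)\<close> survives only
      for \<open>k = d\<close>, with value 1.\<close>
    then have "F x = (\<Sum>k\<le>d. if k = d then pol_eval (pol_component d p) (Y x) else 0)"
      unfolding F_def by (intro sum.cong) (auto simp: t_def power_0_left)
    then have "pol_eval (pol_component d p) (Y x) = 0" using F0 by simp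
    then have "Y x = 0" using assms(4) herm_Y by (simp add: nondegenerate_def)
    then have "x (Some k) = 0" for k
      using coordinate_hermitian_of[of "\<lambda>k. x (Some k)" k] by (simp add: Y_def coordinate_def)
    then show False using x(1) \<open>t = 0\<close> by (cases i) (auto simp: t_def)
  qed
  let ?X = "mscale (complex_of_real (1 / t)) (Y x)"
  have "pol_eval p ?X = (\<Sum>k\<le>d. mscale (complex_of_real (1 / t) ^ k) (pol_eval (pol_component k p) (Y x)))"
    by (simp only: p pol_eval_component_scaled)
  \<comment> \<open>Dehomogenisation: \<open>(1 / t) ^ k\<close> equals
    \<open>(1 / t) ^ d * t ^ (d - k)\<close>.\<close>
  also have "\<dots> = (\<Sum>k\<le>d. mscale (complex_of_real (1 / t) ^ d)
      (mscale (complex_of_real (t ^ (d - k))) (pol_eval (pol_component k p) (Y x))))"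
    using \<open>t \<noteq> 0\<close> by (intro sum.cong) (auto simp: mscale_mscale power_diff power_divide)
  also have "\<dots> = mscale (complex_of_real (1 / t) ^ d) (F x)"
    by (simp only: F_def t_def mscale_sum)
  finally have "pol_eval p ?X = 0" by (simp add: F0 Finite_Cartesian_Product.vec_eq_iff)
  then show ?thesis using hermitian_mscale_real[OF herm_Y] by blast
qed

end
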